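(* Let $\mathcal B$ be a chordal building set on a finite set $S\subset\mathbb N$ with $|S|=2k$, $k\ge2$, such that no connected component of $\mathcal B$ has odd cardinality. Then the order complex $\Delta(\mathcal P_{\mathcal B})$ is shellable, and its geometric realization is homotopy equivalent to a wedge (bouquet) of finitely many $(k-2)$-dimensional spheres.
   Context: A building set on a finite set $S\subset\mathbb N$ is a collection $\mathcal B$ of nonempty subsets of $S$ containing every singleton $\{i\}$, $i\in S$, such that $I,J\in\mathcal B$ and $I\cap J\neq\emptyset$ imply $I\cup J\in\mathcal B$. Its connected components are the inclusion-maximal elements of $\mathcal B$. For $I\subseteq S$, $\mathcal B|_I=\{J\in\mathcal B:J\subseteq I\}$. $\mathcal B$ is chordal if for every $I=\{i_1<\dots<i_r\}\in\mathcal B$ and every $1<s<r$, $\{i_s,\dots,i_r\}\in\mathcal B$. $\widehat{\mathcal P}_{\mathcal B}=\{I\subseteq S:\ \mathcal B|_I\text{ has no connected component of odd cardinality}\}$, ordered by inclusion, and $\mathcal P_{\mathcal B}=\widehat{\mathcal P}_{\mathcal B}\setminus\{\emptyset,S\}$ (the proper part). The order complex $\Delta(P)$ of a poset $P$ is the simplicial complex whose simplices are the finite nonempty chains of $P$. A pure $d$-dimensional simplicial complex is shellable if its facets admit an ordering $F_1,F_2,\dots$ such that $(\bigcup_{i<j}F_i)\cap F_j$ is pure of dimension $d-1$ for each $j\ge2$. *)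

theory Defs
  imports "HOL-Analysis.Analysis"
begin

definition building_set :: "nat set \<Rightarrow> nat set set \<Rightarrow> bool" where
  "building_set S B \<longleftrightarrow>
     finite S \<and>
     (\<forall>I\<in>B. I \<noteq> {} \<and> I \<subseteq> S) \<and>
     (\<forall>i\<in>S. {i} \<in> B) \<and>
     (\<forall>I\<in>B. \<forall>J\<in>B. I \<inter> J \<noteq> {} \<longrightarrow> I \<union> J \<in> B)"

definition bs_components :: "nat set set \<Rightarrow> nat set set" where
  "bs_components B = {I \<in> B. \<forall>J\<in>B. I \<subseteq> J \<longrightarrow> J = I}"

definition bs_restrict :: "nat set set \<Rightarrow> nat set \<Rightarrow> nat set set" where
  "bs_restrict B I = {J \<in> B. J \<subseteq> I}"

definition chordal :: "nat set set \<Rightarrow> bool" where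
  "chordal B \<longleftrightarrow>
     (\<forall>I\<in>B. \<forall>j\<in>I. Min I < j \<and> j < Max I \<longrightarrow> {i \<in> I. j \<le> i} \<in> B)"

definition P_hat :: "nat set \<Rightarrow> nat set set \<Rightarrow> nat set set" where
  "P_hat S B = {I. I \<subseteq> S \<and> (\<forall>C\<in>bs_components (bs_restrict B I). even (card C))}"

definition P_proper :: "nat set \<Rightarrow> nat set set \<Rightarrow> nat set set" where
  "P_proper S B = P_hat S B - {{}, S}"

definition order_complex :: "'a set set \<Rightarrow> 'a set set set" where
  "order_complex P = {c. c \<noteq> {} \<and> finite c \<and> c \<subseteq> P \<and>
                         (\<forall>x\<in>c. \<forall>y\<in>c. x \<subseteq> y \<or> y \<subseteq> x)}"

definition facets :: "'v set set \<Rightarrow> 'v set set" where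
  "facets K = {F \<in> K. \<forall>G\<in>K. F \<subseteq> G \<longrightarrow> G = F}"

definition pure_card :: "'v set set \<Rightarrow> nat \<Rightarrow> bool" where
  "pure_card K m \<longleftrightarrow> (\<forall>F\<in>facets K. card F = m) \<and> (\<forall>G\<in>K. \<exists>F\<in>facets K. G \<subseteq> F)"

text \<open>Shellability of a pure d-dimensional complex: facets (d+1 vertices, here m = d+1)
  can be ordered F_1, F_2, ... such that for j \<ge> 2 the complex
  (union of the simplices F_i, i < j) \<inter> F_j (faces G \<subseteq> F_j lying in some earlier F_i,
  including the empty face) is pure of dimension d - 1.\<close>
definition shellable :: "'v set set \<Rightarrow> bool" where
  "shellable K \<longleftrightarrow>
     (\<exists>m. m \<ge> 1 \<and> pure_card K m \<and>
       (\<exists>fs. distinct fs \<and> set fs = facets K \<and>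
          (\<forall>j. 0 < j \<and> j < length fs \<longrightarrow>
              pure_card {G. G \<subseteq> fs ! j \<and> (\<exists>i<j. G \<subseteq> fs ! i)} (m - 1))))"

text \<open>Geometric realization of a finite simplicial complex with vertices of type 'v:
  the points of the standard simplex in 'v \<Rightarrow> real (product topology) whose support
  is a simplex.\<close>
definition geom_realization :: "'v set set \<Rightarrow> ('v \<Rightarrow> real) set" where
  "geom_realization K =
     {f. (\<forall>v. f v \<ge> 0) \<and> {v. f v \<noteq> 0} \<in> K \<and> (\<Sum>v\<in>{v. f v \<noteq> 0}. f v) = 1}"

text \<open>Wedge of N spheres of dimension n, embedded in nat \<Rightarrow> real: the i-th sphere
  lives in the coordinates i*(n+1), ..., i*(n+1)+n, has radius 1 and centre the unit
  vector at coordinate i*(n+1), so all spheres pass through the origin and pairwise meet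
  only there.  For N = 0 the wedge is the one-point space {0}.\<close>
definition wedge_sphere :: "nat \<Rightarrow> nat \<Rightarrow> (nat \<Rightarrow> real) set" where
  "wedge_sphere n i =
     {x. (\<forall>j. j \<notin> {i*(n+1)..i*(n+1)+n} \<longrightarrow> x j = 0) \<and>
         (x (i*(n+1)) - 1)\<^sup>2 + (\<Sum>j\<in>{i*(n+1)+1..i*(n+1)+n}. (x j)\<^sup>2) = 1}"

definition wedge_of_spheres :: "nat \<Rightarrow> nat \<Rightarrow> (nat \<Rightarrow> real) set" where
  "wedge_of_spheres N n = {\<lambda>_. 0} \<union> (\<Union>i<N. wedge_sphere n i)"

end

theory Submission
  imports Defs "HOL-Library.List_Lexorder"
begin

text \<open>
  Let \<open>x \<subset> y\<close> be members of the poset and let \<open>C\<close> be a component of \<open>y\<close> not contained in \<open>x\<close>. By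
  chordality the elements of \<open>C\<close> above a given one form a connected set, so removing the two smallest
  elements of \<open>C - x\<close> from \<open>y\<close> leaves all components even. Hence every maximal chain decreases by two
  elements at each step. Label the step from \<open>y\<close> to \<open>y - {a < b}\<close> with the maximum of the component
  containing \<open>a\<close>, then \<open>a\<close>, then \<open>b\<close>, and order the maximal chains lexicographically from the top.
  If no exchange of a single member lowers the labels of a chain on an interval, then the chain is
  lexicographically first on that interval; hence the order is a shelling.

  In a shelled complex, the facets whose whole boundary lies in the earlier facets can be left out;
  the others are attached along contractible parts of their boundaries, so the remaining subcomplex
  \<open>A\<close> is contractible. A contraction of \<open>A\<close> extends to a homotopy of the whole complex, so collapsing
  \<open>A\<close> to a point is a homotopy equivalence, and each omitted facet becomes a sphere.
\<close>

subsection \<open>Collapsing a contractible subspace\<close>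

text \<open>The shape of the label answers an obstacle: deleting the two lowest elements of
  \<open>C - x\<close> may break the lower part of \<open>C\<close> into pieces. The part above the
  deleted elements, when nonempty, stays connected, and the piece holding it keeps the maximum of
  \<open>C\<close>. The maximum is therefore the feature of a component that survives such a
  descent, and ranking components by it is what lets least choices on short intervals combine into a
  least choice on a long one. For the homotopy type, the quotient by \<open>A\<close> is realised by
  an explicit map into coordinate space that is injective off \<open>A\<close> and whose image is
  the wedge itself; compactness makes this map a quotient map.\<close>

lemma continuous_on_Min_image:
  fixes f :: "'a::topological_space \<Rightarrow> 'v \<Rightarrow> real"
  assumes "finite R" "R \<noteq> {}" "\<And>v. v \<in> R \<Longrightarrow> continuous_on X (\<lambda>x. f x v)"
  shows "continuous_on X (\<lambda>x. Min (f x ` R))"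
  using assms
proof (induction R rule: finite_ne_induct)
  case (singleton v)
  then show ?case by simp
next
  case (insert v R)
  then have "continuous_on X (\<lambda>x. min (f x v) (Min (f x ` R)))"
    by (intro continuous_on_min) auto
  then show ?case using insert by simp
qed

text \<open>A continuous map from a compact space to a Hausdorff space is closed, hence a quotient
  map onto its image. Maps out of a collapsed space can therefore be tested before
  collapsing.\<close>

lemma continuous_on_factor_compact:
  fixes q :: "'a::topological_space \<Rightarrow> 'b::t2_space" and f :: "'b \<Rightarrow> 'c::topological_space"
  assumes X: "compact X" and q: "continuous_on X q" and fq: "continuous_on X (\<lambda>x. f (q x))"
  shows "continuous_on (q ` X) f"
  unfolding continuous_on_closed_invariant
proof (intro allI impI)
  fix C :: "'c set" assume "closed C"
  then obtain D where D: "closed D" "D \<inter> X = (\<lambda>x. f (q x)) -` C \<inter> X"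
    using fq unfolding continuous_on_closed_invariant by blast
  have "compact (q ` (D \<inter> X))"
    using compact_Int_closed[OF X D(1)]
    by (intro compact_continuous_image continuous_on_subset[OF q]) (auto simp: Int_commute)
  then have "closed (q ` (D \<inter> X))" by (rule compact_imp_closed)
  moreover have "q ` (D \<inter> X) \<inter> q ` X = f -` C \<inter> q ` X" using D by auto
  ultimately show "\<exists>A. closed A \<and> A \<inter> q ` X = f -` C \<inter> q ` X" by blast
qed

lemma homotopic_with_top_of_setI:
  fixes h :: "real \<times> 'a::topological_space \<Rightarrow> 'b::topological_space"
  assumes "continuous_on ({0..1} \<times> X) h" "h ` ({0..1} \<times> X) \<subseteq> Y"
    "\<And>x. x \<in> X \<Longrightarrow> h (0, x) = p x" "\<And>x. x \<in> X \<Longrightarrow> h (1, x) = q x"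
  shows "homotopic_with (\<lambda>_. True) (top_of_set X) (top_of_set Y) p q"
proof -
  have "homotopic_with (\<lambda>_. True) (top_of_set X) (top_of_set Y) (\<lambda>x. h (0, x)) (\<lambda>x. h (1, x))"
    unfolding homotopic_with_def using assms(1,2) by (intro exI[of _ h]) auto
  then show ?thesis
    by (rule homotopic_with_eq) (use assms in auto)
qed

text \<open>The end map \<open>h (1, _)\<close> is constant on \<open>A\<close>, the only set on
  which \<open>q\<close> identifies points, so it descends to \<open>g\<close>. Since
  \<open>h\<close> keeps \<open>A\<close> inside \<open>A\<close>, the composite of \<open>q\<close>
  with \<open>h\<close> descends to a homotopy \<open>k\<close> of the image. Then \<open>h\<close>
  and \<open>k\<close> connect the identities with the two composites of \<open>q\<close> and
  \<open>g\<close>.\<close>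

lemma collapse_homotopy_equivalent:
  fixes X :: "'a::topological_space set" and q :: "'a \<Rightarrow> 'b::t2_space"
  assumes X: "compact X" and AX: "A \<subseteq> X" and q: "continuous_on X q"
    and inj: "\<And>x y. x \<in> X \<Longrightarrow> y \<in> X \<Longrightarrow> q x = q y \<Longrightarrow> x = y \<or> x \<in> A \<and> y \<in> A"
    and qA: "\<And>x. x \<in> A \<Longrightarrow> q x = w0"
    and h: "continuous_on ({0..1} \<times> X) h" "h ` ({0..1} \<times> X) \<subseteq> X"
    and h0: "\<And>x. x \<in> X \<Longrightarrow> h (0, x) = x"
    and hA: "\<And>t x. t \<in> {0..1} \<Longrightarrow> x \<in> A \<Longrightarrow> h (t, x) \<in> A"
    and h1: "\<And>x. x \<in> A \<Longrightarrow> h (1::real, x) = a"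
  shows "top_of_set X homotopy_equivalent_space top_of_set (q ` X)"
proof -
  \<comment> \<open>An arbitrary section of \<open>q\<close>, in general discontinuous;
    \<open>gq\<close> and \<open>kq\<close> show that the maps built from it do not depend on the
    choice.\<close>
  define r where "r = inv_into X q"
  have r: "r w \<in> X" "q (r w) = w" if "w \<in> q ` X" for w
    using that by (auto simp: r_def f_inv_into_f inv_into_into)
  have rq: "r (q x) = x \<or> r (q x) \<in> A \<and> x \<in> A" if "x \<in> X" for x
    using inj[of "r (q x)" x] r[of "q x"] that by auto
  define g where "g w = h (1, r w)" for w
  define k where "k = (\<lambda>(t, w). q (h (t, r w)))"
  have gq: "g (q x) = h (1, x)" if "x \<in> X" for x
    using rq[OF that] h1 by (auto simp: g_def)
  have kq: "k (t, q x) = q (h (t, x))" if "x \<in> X" "t \<in> {0..1}" for t x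
    using rq[OF that(1)] hA[OF that(2)] qA by (auto simp: k_def)
  have h1c: "continuous_on X (\<lambda>x. h (1, x))"
    by (rule continuous_on_compose2[OF h(1)]) (auto intro!: continuous_intros)
  have g: "continuous_on (q ` X) g"
    by (rule continuous_on_factor_compact[OF X q]) (use h1c gq in \<open>simp cong: continuous_on_cong\<close>)
  have gX: "g ` q ` X \<subseteq> X" using gq h(2) by force
  define Q where "Q = (\<lambda>p::real \<times> 'a. (fst p, q (snd p)))"
  have QI: "Q ` ({0..1} \<times> X) = {0..1} \<times> q ` X" by (force simp: Q_def)
  have "continuous_on (Q ` ({0..1} \<times> X)) k"
  proof (rule continuous_on_factor_compact)
    show "compact ({0..1::real} \<times> X)" using X by (intro compact_Times) auto
    show "continuous_on ({0..1} \<times> X) Q" unfolding Q_def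
      by (intro continuous_intros continuous_on_compose2[OF q]) auto
    have "continuous_on ({0..1} \<times> X) (\<lambda>p. q (h p))"
      by (rule continuous_on_compose2[OF q h(1)]) (use h(2) in auto)
    then show "continuous_on ({0..1} \<times> X) (\<lambda>p. k (Q p))"
      by (rule continuous_on_eq) (use kq in \<open>auto simp: Q_def\<close>)
  qed
  then have kc: "continuous_on ({0..1} \<times> q ` X) k" unfolding QI .
  have "homotopic_with (\<lambda>_. True) (top_of_set (q ` X)) (top_of_set (q ` X)) id (q \<circ> g)"
  proof (rule homotopic_with_top_of_setI[OF kc])
    show "k ` ({0..1} \<times> q ` X) \<subseteq> q ` X" using kq h(2) by (force simp: image_subset_iff)
  qed (auto simp: kq gq h0)
  moreover have "homotopic_with (\<lambda>_. True) (top_of_set X) (top_of_set X) id (g \<circ> q)"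
    by (rule homotopic_with_top_of_setI[OF h]) (auto simp: gq h0)
  ultimately show ?thesis
    unfolding homotopy_equivalent_space_def
    by (intro exI[of _ q] exI[of _ g]) (use q g gX in \<open>auto simp: homotopic_with_sym\<close>)
qed

subsection \<open>Contractible geometric realizations\<close>

lemma geom_realizationI:
  assumes "finite F" "\<And>v. 0 \<le> x v" "\<And>v. v \<notin> F \<Longrightarrow> x v = 0" "sum x F = 1" "{v. x v \<noteq> 0} \<in> K"
  shows "x \<in> geom_realization K"
proof -
  have "sum x {v. x v \<noteq> 0} = sum x F"
    by (rule sum.mono_neutral_left) (use assms in auto)
  then show ?thesis using assms by (auto simp: geom_realization_def)
qed

lemma geom_realizationD:
  assumes "x \<in> geom_realization K"
  shows "0 \<le> x v" "{v. x v \<noteq> 0} \<in> K" "finite {v. x v \<noteq> 0}" "{v. x v \<noteq> 0} \<noteq> {}" "x v \<le> 1"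
    "\<lbrakk>finite F; {v. x v \<noteq> 0} \<subseteq> F\<rbrakk> \<Longrightarrow> sum x F = 1"
proof -
  have x: "\<And>v. 0 \<le> x v" "{v. x v \<noteq> 0} \<in> K" "sum x {v. x v \<noteq> 0} = 1"
    using assms by (auto simp: geom_realization_def)
  show "0 \<le> x v" "{v. x v \<noteq> 0} \<in> K" by (fact x)+
  show fin: "finite {v. x v \<noteq> 0}"
  proof (rule ccontr)
    assume "infinite {v. x v \<noteq> 0}"
    then show False using x(3) sum.infinite by fastforce
  qed
  show "{v. x v \<noteq> 0} \<noteq> {}" using x(3) by (metis sum.empty zero_neq_one)
  show "x v \<le> 1"
  proof (cases "x v = 0")
    case False
    then have "x v \<le> sum x {v. x v \<noteq> 0}" by (intro member_le_sum) (use fin x in auto)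
    then show ?thesis using x by simp
  qed simp
  assume "finite F" "{v. x v \<noteq> 0} \<subseteq> F"
  then have "sum x {v. x v \<noteq> 0} = sum x F"
    by (intro sum.mono_neutral_left) auto
  then show "sum x F = 1" using x by simp
qed

lemma continuous_on_snd_apply:
  "continuous_on A (\<lambda>p::'a::topological_space \<times> ('v \<Rightarrow> 'b::topological_space). snd p v)"
  by (rule continuous_on_product_then_coordinatewise) (intro continuous_intros)

lemma Min_image_nonneg:
  assumes "finite R" "R \<noteq> {}" "\<And>v. v \<in> R \<Longrightarrow> (0::real) \<le> x v"
  shows "0 \<le> Min (x ` R)"
  using assms by (simp add: Min_ge_iff)

lemma Min_image_pos_iff:
  assumes "finite R" "R \<noteq> {}" "\<And>v. (0::real) \<le> x v"
  shows "0 < Min (x ` R) \<longleftrightarrow> R \<subseteq> {v. x v \<noteq> 0}"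
  using assms by (subst Min_gr_iff) (auto simp: less_le)

lemma Min_image_le:
  assumes "finite R" "v \<in> R"
  shows "Min (x ` R) \<le> (x v :: real)"
  using assms by auto

text \<open>Pushing a point \<open>x\<close> of the new simplices away from \<open>R\<close>, in the direction of the
  barycentre of \<open>F - R\<close>, until one of the coordinates in \<open>R\<close> vanishes.\<close>

lemma contractible_realization_attach:
  fixes F :: "'v set"
  assumes F: "finite F" "R \<subset> F" "R \<noteq> {}"
    and sub: "\<And>v G. v \<in> R \<Longrightarrow> G \<subseteq> F - {v} \<Longrightarrow> G \<noteq> {} \<Longrightarrow> G \<in> L"
    and new: "\<And>G. G \<in> L \<Longrightarrow> \<not> R \<subseteq> G"
    and con: "contractible_space (top_of_set (geom_realization L))"
  shows "contractible_space (top_of_set (geom_realization (L \<union> (Pow F - {{}}))))"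
proof -
  define X where "X = geom_realization (L \<union> (Pow F - {{}}))"
  define Y where "Y = geom_realization L"
  have YX: "Y \<subseteq> X" unfolding X_def Y_def by (auto simp: geom_realization_def)
  have R: "finite R" using F by (meson finite_subset psubset_imp_subset)
  define mu where "mu x = Min (x ` R)" for x :: "'v \<Rightarrow> real"
  \<comment> \<open>The entries on \<open>F - R\<close> make \<open>c\<close> sum to 0 over
    \<open>F\<close>, which preserves total mass. They are nonpositive, so only coordinates in
    \<open>R\<close> decrease, and these by at most their minimum \<open>mu x\<close>.\<close>
  define c :: "'v \<Rightarrow> real"
    where "c v = (if v \<in> R then 1 else if v \<in> F then - (card R / card (F - R)) else 0)" for v
  define h where "h = (\<lambda>(t, x) v. x v - t * mu x * c v)"
  have FR: "card (F - R) > 0" using F by (simp add: card_gt_0_iff)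
  have sum_c: "sum c F = 0"
  proof -
    have "sum c F = sum c R + sum c (F - R)"
      using F by (metis psubset_imp_subset sum.subset_diff add.commute)
    also have "sum c R = card R" by (simp add: c_def)
    also have "sum c (F - R) = (\<Sum>v\<in>F-R. - (card R / card (F - R)))"
      by (rule sum.cong) (auto simp: c_def)
    finally show ?thesis using FR by simp
  qed
  have mu_cont: "continuous_on UNIV mu" unfolding mu_def
    by (intro continuous_on_Min_image R F continuous_on_product_coordinates)
  have h_cont: "continuous_on UNIV h" unfolding h_def case_prod_beta
    by (intro continuous_on_coordinatewise_then_product continuous_intros continuous_on_snd_apply
        continuous_on_compose2[OF mu_cont continuous_on_snd]) auto
  have mu_Y: "mu x = 0" if "x \<in> Y" for x
  proof -
    note x = geom_realizationD[OF that[unfolded Y_def]]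
    have "\<not> 0 < mu x"
      unfolding mu_def Min_image_pos_iff[OF R F(3) x(1)] by (rule new[OF x(2)])
    moreover have "0 \<le> mu x"
      unfolding mu_def by (rule Min_image_nonneg[OF R F(3) x(1)])
    ultimately show ?thesis by simp
  qed
  have h_Y: "h (t, x) = x" if "x \<in> Y" for t x
    using mu_Y[OF that] by (simp add: h_def)
  have new_pt: "h (t, x) \<in> X \<and> (t = 1 \<longrightarrow> h (t, x) \<in> Y)"
    if x: "x \<in> X" "x \<notin> Y" and t: "t \<in> {0..1}" for t x
  proof -
    note D = geom_realizationD[OF x(1)[unfolded X_def]]
    have supp: "{v. x v \<noteq> 0} \<subseteq> F"
      using x D(2) by (auto simp: X_def Y_def geom_realization_def)
    have mu: "0 \<le> mu x" unfolding mu_def by (rule Min_image_nonneg[OF R F(3) D(1)])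
    have pos: "0 \<le> h (t, x) v" for v
    proof (cases "v \<in> R")
      case True
      then have "mu x \<le> x v" unfolding mu_def using R by (rule Min_image_le[rotated])
      moreover have "t * mu x \<le> mu x" using mu t by (simp add: mult_left_le_one_le)
      ultimately show ?thesis using True by (simp add: h_def c_def)
    next
      case False
      then have "c v \<le> 0" by (simp add: c_def)
      then have "t * mu x * c v \<le> 0" using mu t by (simp add: mult_nonneg_nonpos)
      then show ?thesis using D(1)[of v] by (simp add: h_def)
    qed
    have out: "h (t, x) v = 0" if "v \<notin> F" for v
      using that supp F by (auto simp: h_def c_def)
    have sum: "sum (h (t, x)) F = 1"
    proof -
      have "sum (h (t, x)) F = sum x F - (t * mu x) * sum c F"
        unfolding h_def by (simp add: sum_subtractf sum_distrib_left)
      then show ?thesis using sum_c D(6)[OF F(1) supp] by simp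
    qed
    have ne: "{v. h (t, x) v \<noteq> 0} \<noteq> {}"
    proof
      assume "{v. h (t, x) v \<noteq> 0} = {}"
      then have "sum (h (t, x)) F = 0" by (intro sum.neutral) auto
      then show False using sum by simp
    qed
    have sF: "{v. h (t, x) v \<noteq> 0} \<subseteq> F" using out by auto
    have "h (t, x) \<in> X" unfolding X_def
      by (rule geom_realizationI[OF F(1) pos out sum]) (use sF ne in auto)
    moreover have "h (t, x) \<in> Y" if "t = 1"
    proof -
      have "mu x \<in> x ` R" unfolding mu_def by (rule Min_in) (use R F in auto)
      then obtain v where v: "v \<in> R" "mu x = x v" by auto
      then have "h (t, x) v = 0" using that by (simp add: h_def c_def)
      then have "{v. h (t, x) v \<noteq> 0} \<subseteq> F - {v}" using sF by auto
      then have "{v. h (t, x) v \<noteq> 0} \<in> L" using sub v ne by blast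
      then show ?thesis unfolding Y_def by (intro geom_realizationI[OF F(1) pos out sum])
    qed
    ultimately show ?thesis by blast
  qed
  have hX: "h (t, x) \<in> X" if "x \<in> X" "t \<in> {0..1}" for t x
    using new_pt[of x t] h_Y[of x t] that by (cases "x \<in> Y") auto
  have h1: "h (1, x) \<in> Y" if "x \<in> X" for x
    using new_pt[of x 1] h_Y[of x 1] that by (cases "x \<in> Y") auto
  have "homotopic_with (\<lambda>_. True) (top_of_set X) (top_of_set X) id (\<lambda>x. h (1, x))"
  proof (rule homotopic_with_top_of_setI)
    show "continuous_on ({0..1} \<times> X) h" by (rule continuous_on_subset[OF h_cont]) simp
  qed (use hX in \<open>auto simp: h_def\<close>)
  moreover have "continuous_on X (\<lambda>x. h (1, x))"
    by (rule continuous_on_compose2[OF h_cont]) (auto intro!: continuous_on_Pair continuous_on_const continuous_on_id)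
  then have "retraction_maps (top_of_set X) (top_of_set Y) (\<lambda>x. h (1, x)) id"
    unfolding retraction_maps_def using h1 h_Y YX by (auto simp: image_subset_iff)
  ultimately have "top_of_set X homotopy_equivalent_space top_of_set Y"
    by (intro deformation_retract_imp_homotopy_equivalent_space) (auto simp: homotopic_with_sym)
  then show ?thesis
    using con homotopy_equivalent_space_contractibility unfolding X_def Y_def by blast
qed

section \<open>Compactness of realizations and contractibility of a simplex\<close>

lemma geom_realization_simplex_iff:
  assumes F: "finite F"
  shows "x \<in> geom_realization (Pow F - {{}}) \<longleftrightarrow>
    (\<forall>v. 0 \<le> x v) \<and> (\<forall>v. v \<notin> F \<longrightarrow> x v = 0) \<and> sum x F = 1"
proof
  assume "x \<in> geom_realization (Pow F - {{}})"
  note D = geom_realizationD[OF this]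
  then have "{v. x v \<noteq> 0} \<subseteq> F" by simp
  then show "(\<forall>v. 0 \<le> x v) \<and> (\<forall>v. v \<notin> F \<longrightarrow> x v = 0) \<and> sum x F = 1"
    using D(1) D(6)[OF F] by blast
next
  assume x: "(\<forall>v. 0 \<le> x v) \<and> (\<forall>v. v \<notin> F \<longrightarrow> x v = 0) \<and> sum x F = 1"
  then have "{v. x v \<noteq> 0} \<noteq> {}" by (metis (mono_tags) empty_Collect_eq sum.neutral zero_neq_one)
  then show "x \<in> geom_realization (Pow F - {{}})" using x F by (intro geom_realizationI[of F]) auto
qed

text \<open>The vertex type may be infinite, so the simplex is placed in a full product of compact
  sets, \<open>{0..1}\<close> on \<open>F\<close> and \<open>{0}\<close> elsewhere. Tychonoff's
  theorem applies, and the mass condition cuts out a closed subset.\<close>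

lemma compact_realization_simplex:
  fixes F :: "'v set"
  assumes F: "finite F"
  shows "compact (geom_realization (Pow F - {{}}))"
proof -
  define T where "T = (\<Pi>\<^sub>E v\<in>(UNIV::'v set). if v \<in> F then {0..1} else {0::real})"
  have "compactin (product_topology (\<lambda>_. euclidean) UNIV) T"
    unfolding T_def compactin_PiE by auto
  then have "compact T" by (simp add: euclidean_product_topology)
  moreover have "closed {x::'v \<Rightarrow> real. sum x F = 1}"
    by (intro closed_Collect_eq continuous_intros continuous_on_product_coordinates)
  moreover have "geom_realization (Pow F - {{}}) = T \<inter> {x. sum x F = 1}"
  proof (intro set_eqI iffI)
    fix x assume x: "x \<in> geom_realization (Pow F - {{}})"
    show "x \<in> T \<inter> {x. sum x F = 1}"
      using x geom_realizationD(5)[OF x] unfolding geom_realization_simplex_iff[OF F] T_def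
      by (auto simp: PiE_iff)
  next
    fix x assume "x \<in> T \<inter> {x. sum x F = 1}"
    then have x: "x v \<in> (if v \<in> F then {0..1} else {0})" "sum x F = 1" for v
      by (auto simp: T_def PiE_iff)
    show "x \<in> geom_realization (Pow F - {{}})"
      unfolding geom_realization_simplex_iff[OF F]
    proof (intro conjI allI impI x(2))
      show "0 \<le> x v" for v using x(1)[of v] by (auto split: if_splits)
      show "x v = 0" if "v \<notin> F" for v using x(1)[of v] that by auto
    qed
  qed
  ultimately show ?thesis by (simp add: compact_Int_closed)
qed

lemma compact_geom_realization:
  assumes "finite K" "\<And>G. G \<in> K \<Longrightarrow> finite G" "\<And>G G'. G \<in> K \<Longrightarrow> G' \<subseteq> G \<Longrightarrow> G' \<noteq> {} \<Longrightarrow> G' \<in> K"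
  shows "compact (geom_realization K)"
proof -
  have "geom_realization K = (\<Union>G\<in>K. geom_realization (Pow G - {{}}))"
  proof (intro set_eqI iffI)
    fix x assume x: "x \<in> geom_realization K"
    note D = geom_realizationD[OF x]
    have "x \<in> geom_realization (Pow {v. x v \<noteq> 0} - {{}})"
      using x D(4) by (auto simp: geom_realization_def)
    then show "x \<in> (\<Union>G\<in>K. geom_realization (Pow G - {{}}))" using D(2) by blast
  next
    fix x assume "x \<in> (\<Union>G\<in>K. geom_realization (Pow G - {{}}))"
    then obtain G where G: "G \<in> K" "x \<in> geom_realization (Pow G - {{}})" by blast
    then have "{v. x v \<noteq> 0} \<in> K" using assms(3)[OF G(1)] geom_realizationD(2)[OF G(2)] by blast
    then show "x \<in> geom_realization K" using G(2) by (auto simp: geom_realization_def)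
  qed
  then show ?thesis using assms(1,2) by (auto intro!: compact_UN compact_realization_simplex)
qed

lemma contractible_realization_simplex:
  fixes F :: "'v set"
  assumes F: "finite F" "F \<noteq> {}"
  shows "contractible_space (top_of_set (geom_realization (Pow F - {{}})))"
proof -
  define X where "X = geom_realization (Pow F - {{}})"
  have X: "x \<in> X \<longleftrightarrow> (\<forall>v. 0 \<le> x v) \<and> (\<forall>v. v \<notin> F \<longrightarrow> x v = 0) \<and> sum x F = 1" for x
    unfolding X_def by (rule geom_realization_simplex_iff[OF F(1)])
  define a where "a = (\<lambda>v. if v \<in> F then 1 / card F else 0 :: real)"
  have a: "a \<in> X" unfolding X using F by (simp add: a_def)
  define h where "h = (\<lambda>(t, x) v. (1 - t) * x v + t * a v)"
  have "homotopic_with (\<lambda>_. True) (top_of_set X) (top_of_set X) id (\<lambda>x. a)"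
  proof (rule homotopic_with_top_of_setI)
    show "continuous_on ({0..1} \<times> X) h" unfolding h_def case_prod_beta
      by (intro continuous_on_coordinatewise_then_product continuous_intros continuous_on_snd_apply)
    have "h (t, x) \<in> X" if "t \<in> {0..1}" "x \<in> X" for t x
      using that a unfolding X h_def
      by (auto simp: sum.distrib sum_distrib_left[symmetric])
    then show "h ` ({0..1} \<times> X) \<subseteq> X" by auto
  qed (auto simp: h_def)
  then show ?thesis unfolding X_def contractible_space_def by auto
qed

subsection \<open>Attaching simplices along their boundaries\<close>

text \<open>\<open>L\<close> is to become the contractible part and the \<open>e i\<close> the
  simplices that turn into spheres. The enumerations \<open>vx i\<close> fix coordinates on each
  simplex, vertex 0 being the one whose coordinate will be dropped. The last assumption keeps the
  interiors of the \<open>e i\<close> disjoint from \<open>A\<close>.\<close>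

locale top_simplices =
  fixes L :: "'v set set" and N n :: nat and e :: "nat \<Rightarrow> 'v set" and vx :: "nat \<Rightarrow> nat \<Rightarrow> 'v"
  assumes fin_L: "finite L" and fin_face: "\<And>G. G \<in> L \<Longrightarrow> finite G"
    and down: "\<And>G G'. G \<in> L \<Longrightarrow> G' \<subseteq> G \<Longrightarrow> G' \<noteq> {} \<Longrightarrow> G' \<in> L"
    and vx: "\<And>i. i < N \<Longrightarrow> bij_betw (vx i) {..n} (e i)"
    and inj_e: "inj_on e {..<N}"
    and boundary: "\<And>i G. i < N \<Longrightarrow> G \<subset> e i \<Longrightarrow> G \<noteq> {} \<Longrightarrow> G \<in> L"
    and top: "\<And>i G. i < N \<Longrightarrow> G \<in> L \<Longrightarrow> \<not> e i \<subseteq> G"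
begin

definition A where "A = geom_realization L"
definition X where "X = geom_realization (L \<union> e ` {..<N})"
text \<open>On \<open>X\<close> this is positive exactly in the interior of the simplex
  \<open>e i\<close>, with largest value 1/(n+1) at the barycentre. It serves as a continuous
  measure of distance from the boundary.\<close>

definition mu where "mu i x = Min (x ` e i)" for i and x :: "'v \<Rightarrow> real"
abbreviation supp where "supp x \<equiv> {v. x v \<noteq> (0::real)}"

lemma AX: "A \<subseteq> X"
  by (auto simp: A_def X_def geom_realization_def)

lemma e_fin: "i < N \<Longrightarrow> finite (e i)" and e_card: "i < N \<Longrightarrow> card (e i) = n + 1"
  and e_ne: "i < N \<Longrightarrow> e i \<noteq> {}" and e_vx: "i < N \<Longrightarrow> e i = vx i ` {..n}"
proof -
  assume i: "i < N"
  show "card (e i) = n + 1" using bij_betw_same_card[OF vx[OF i]] by simp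
  then show "finite (e i)" "e i \<noteq> {}" by (auto intro: card_ge_0_finite)
  show "e i = vx i ` {..n}" using vx[OF i] by (simp add: bij_betw_def)
qed

lemma X_nonneg: "x \<in> X \<Longrightarrow> 0 \<le> x v" and X_le_1: "x \<in> X \<Longrightarrow> x v \<le> 1"
  unfolding X_def by (simp_all add: geom_realizationD)

lemma mu_nonneg: "x \<in> X \<Longrightarrow> i < N \<Longrightarrow> 0 \<le> mu i x"
  unfolding mu_def by (intro Min_image_nonneg e_fin e_ne X_nonneg)

lemma mu_le: "v \<in> e i \<Longrightarrow> i < N \<Longrightarrow> mu i x \<le> x v"
  unfolding mu_def by (intro Min_image_le e_fin)

lemma mu_le_1: "x \<in> X \<Longrightarrow> i < N \<Longrightarrow> mu i x \<le> 1"
  using mu_le e_ne X_le_1 by (meson all_not_in_conv order_trans)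

lemma mu_pos_iff: "x \<in> X \<Longrightarrow> i < N \<Longrightarrow> 0 < mu i x \<longleftrightarrow> e i \<subseteq> supp x"
  unfolding mu_def by (intro Min_image_pos_iff e_fin e_ne X_nonneg)

lemma mu_zero_iff: "x \<in> X \<Longrightarrow> i < N \<Longrightarrow> mu i x = 0 \<longleftrightarrow> \<not> e i \<subseteq> supp x"
  using mu_pos_iff[of x i] mu_nonneg[of x i] by auto

lemma mu_A: "x \<in> A \<Longrightarrow> i < N \<Longrightarrow> mu i x = 0"
proof -
  assume x: "x \<in> A" and i: "i < N"
  then have "\<not> e i \<subseteq> supp x" using top[OF i] geom_realizationD(2) unfolding A_def by blast
  then show "mu i x = 0" using mu_zero_iff x i AX by auto
qed

lemma X_cases:
  assumes "x \<in> X"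
  obtains "x \<in> A" | i where "i < N" "supp x = e i"
  using assms by (auto simp: A_def X_def geom_realization_def)

lemma mu_other:
  assumes "x \<in> X" "i < N" "supp x = e i" "j < N" "j \<noteq> i"
  shows "mu j x = 0"
proof -
  have "\<not> e j \<subseteq> e i"
  proof
    assume "e j \<subseteq> e i"
    then have "e j = e i" by (intro card_subset_eq) (use assms e_fin e_card in auto)
    then show False using inj_e assms by (auto simp: inj_on_def)
  qed
  then show ?thesis using mu_zero_iff[OF assms(1,4)] assms(3) by auto
qed

lemma sum_top:
  assumes "x \<in> X" "i < N" "supp x = e i"
  shows "sum x (e i) = 1"
  using assms geom_realizationD(6)[of x _ "e i"] e_fin unfolding X_def by auto

lemma mu_top_le:
  assumes "x \<in> X" "i < N" "supp x = e i"
  shows "(n + 1) * mu i x \<le> 1"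
proof -
  have "of_nat (card (e i)) * mu i x \<le> sum x (e i)"
    by (rule sum_bounded_below) (use mu_le assms in auto)
  then show ?thesis using sum_top[OF assms] e_card assms by auto
qed

lemma topI:
  assumes "i < N" "\<And>v. 0 \<le> x v" "\<And>v. v \<notin> e i \<Longrightarrow> x v = 0" "sum x (e i) = 1"
  shows "x \<in> X" "v \<in> e i \<Longrightarrow> x v = 0 \<Longrightarrow> x \<in> A"
proof -
  have ne: "supp x \<noteq> {}"
    using assms(4) by (metis (mono_tags) empty_Collect_eq sum.neutral zero_neq_one)
  have sub: "supp x \<subseteq> e i" using assms(3) by auto
  show "x \<in> X" unfolding X_def
    by (rule geom_realizationI[OF e_fin[OF assms(1)] assms(2-4)])
      (use sub ne assms(1) boundary[OF assms(1), of "supp x"] in auto)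
  show "x \<in> A" if "v \<in> e i" "x v = 0" unfolding A_def
    by (rule geom_realizationI[OF e_fin[OF assms(1)] assms(2-4)])
      (use sub ne that in \<open>auto intro!: boundary[OF assms(1), of "supp x"]\<close>)
qed

lemma mu_attained:
  assumes "i < N"
  obtains v where "v \<in> e i" "x v = mu i x"
proof -
  have "mu i x \<in> x ` e i" unfolding mu_def by (rule Min_in) (use e_fin e_ne assms in auto)
  then show ?thesis using that by auto
qed

lemma continuous_mu: "i < N \<Longrightarrow> continuous_on UNIV (mu i)"
  unfolding mu_def by (intro continuous_on_Min_image e_fin e_ne continuous_on_product_coordinates)

lemma compact_X: "compact X" unfolding X_def
proof (rule compact_geom_realization)
  show "finite (L \<union> e ` {..<N})" using fin_L by simp
  show "finite G" if "G \<in> L \<union> e ` {..<N}" for G using that fin_face e_fin by auto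
  show "G' \<in> L \<union> e ` {..<N}" if "G \<in> L \<union> e ` {..<N}" "G' \<subseteq> G" "G' \<noteq> {}" for G G'
    using that down boundary by (metis Un_iff image_iff lessThan_iff psubsetI)
qed

section \<open>Pushing points of the attached simplices radially towards the boundary\<close>

definition M where "M x = (n + 1) * (\<Sum>i<N. mu i x)"
definition den where "den \<tau> x = 1 - (n + 1) * (\<Sum>i<N. min (mu i x) \<tau>)"
text \<open>At most one \<open>mu i x\<close> is nonzero on \<open>X\<close>, so the sums over all
  \<open>i\<close> select the simplex containing \<open>x\<close> while the formula needs no case
  distinction. Subtracting an equal amount from all coordinates of \<open>e i\<close> and
  renormalising by \<open>den\<close> moves \<open>x\<close> along the ray from the barycentre; the
  boundary is reached once the cap \<open>\<tau>\<close> is at least \<open>mu i x\<close>.\<close>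

definition push where "push \<tau> x =
  (\<lambda>v. (x v - (\<Sum>i<N. if v \<in> e i then min (mu i x) \<tau> else 0)) / den \<tau> x)"

lemma push_A: "x \<in> A \<Longrightarrow> 0 \<le> \<tau> \<Longrightarrow> push \<tau> x = x" and den_A: "x \<in> A \<Longrightarrow> 0 \<le> \<tau> \<Longrightarrow> den \<tau> x = 1"
  and M_A: "x \<in> A \<Longrightarrow> M x = 0"
  by (auto simp: push_def den_def M_def mu_A sum.neutral)

lemma push_top:
  assumes x: "x \<in> X" "i < N" "supp x = e i" and \<tau>: "0 \<le> \<tau>"
  shows "M x = (n + 1) * mu i x"
    and "den \<tau> x = 1 - (n + 1) * min (mu i x) \<tau>"
    and "push \<tau> x v = (x v - (if v \<in> e i then min (mu i x) \<tau> else 0)) / den \<tau> x"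
proof -
  have other: "mu j x = 0" if "j \<in> {..<N} - {i}" for j
    using mu_other[OF x] that by auto
  have mt: "min (mu j x) \<tau> = 0" if "j \<in> {..<N} - {i}" for j
    using other[OF that] \<tau> by simp
  have "(\<Sum>j<N. mu j x) = mu i x"
    using x(2) other by (subst sum.remove[of _ i]) auto
  then show "M x = (n + 1) * mu i x" by (simp add: M_def)
  have "(\<Sum>j<N. min (mu j x) \<tau>) = min (mu i x) \<tau>"
    using x(2) mt by (subst sum.remove[of _ i]) auto
  then show "den \<tau> x = 1 - (n + 1) * min (mu i x) \<tau>" by (simp add: den_def)
  have "(\<Sum>j<N. if v \<in> e j then min (mu j x) \<tau> else 0) = (if v \<in> e i then min (mu i x) \<tau> else 0)"
  proof -
    have "(\<Sum>j\<in>{..<N} - {i}. if v \<in> e j then min (mu j x) \<tau> else 0) = 0"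
      by (rule sum.neutral) (use mt in simp)
    then show ?thesis using x(2) by (subst sum.remove[of _ i]) auto
  qed
  then show "push \<tau> x v = (x v - (if v \<in> e i then min (mu i x) \<tau> else 0)) / den \<tau> x"
    by (simp add: push_def)
qed

lemma M_bounds: "x \<in> X \<Longrightarrow> 0 \<le> M x" "x \<in> X \<Longrightarrow> M x \<le> 1"
proof -
  assume x: "x \<in> X"
  then show "0 \<le> M x" unfolding M_def by (intro mult_nonneg_nonneg sum_nonneg) (auto intro: mu_nonneg)
  show "M x \<le> 1" using x
  proof (cases rule: X_cases)
    case (2 i)
    then show ?thesis using push_top(1)[OF x 2, of 1] mu_top_le[OF x 2] by simp
  qed (simp add: M_A)
qed

text \<open>At a barycentre the denominator vanishes as soon as the cap reaches 1/(n+1). It is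
  bounded below either by a small cap or by distance from the barycentre; these alternatives are the
  two regimes of the extended homotopy.\<close>

lemma den_ge:
  assumes x: "x \<in> X" and \<tau>: "0 \<le> \<tau>" "\<tau> \<le> 1 / (2 * (n + 1)) \<or> M x \<le> 1 / 2"
  shows "1 / 2 \<le> den \<tau> x"
  using x
proof (cases rule: X_cases)
  case 1
  then show ?thesis using den_A \<tau> by simp
next
  case (2 i)
  note p = push_top[OF x 2 \<tau>(1)]
  have "(n + 1) * min (mu i x) \<tau> \<le> 1 / 2"
  proof -
    have "(n + 1) * min (mu i x) \<tau> \<le> (n + 1) * \<tau>" "(n + 1) * min (mu i x) \<tau> \<le> (n + 1) * mu i x"
      by (intro mult_left_mono; simp)+
    moreover have "(n + 1) * \<tau> \<le> 1 / 2" if "\<tau> \<le> 1 / (2 * (n + 1))"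
      using that by (simp add: field_simps)
    ultimately show ?thesis using \<tau>(2) p(1) by linarith
  qed
  then show ?thesis using p(2) by simp
qed

lemma push_X:
  assumes x: "x \<in> X" and \<tau>: "0 \<le> \<tau>" "\<tau> \<le> 1 / (2 * (n + 1)) \<or> M x \<le> 1 / 2"
  shows "push \<tau> x \<in> X" and "1 \<le> \<tau> \<Longrightarrow> push \<tau> x \<in> A"
proof -
  have "push \<tau> x \<in> X \<and> (1 \<le> \<tau> \<longrightarrow> push \<tau> x \<in> A)"
    using x
  proof (cases rule: X_cases)
    case 1
    then show ?thesis using push_A \<tau> AX by auto
  next
    case (2 i)
    note p = push_top[OF x 2 \<tau>(1)]
    have d: "den \<tau> x > 0" using den_ge[OF assms] by simp
    have pos: "0 \<le> push \<tau> x v" for v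
    proof -
      have "(if v \<in> e i then min (mu i x) \<tau> else 0) \<le> x v"
        using mu_le[of v i x] 2 X_nonneg[OF x] by (auto simp: min_def)
      then show ?thesis unfolding p(3) using d by simp
    qed
    have out: "push \<tau> x v = 0" if "v \<notin> e i" for v
      using that 2 unfolding p(3) by auto
    have sum: "sum (push \<tau> x) (e i) = 1"
    proof -
      have "sum (push \<tau> x) (e i) = (\<Sum>v\<in>e i. (x v - min (mu i x) \<tau>) / den \<tau> x)"
        by (rule sum.cong) (auto simp: p(3))
      also have "\<dots> = (1 - (n + 1) * min (mu i x) \<tau>) / den \<tau> x"
        by (simp add: sum_divide_distrib[symmetric] sum_subtractf sum_top[OF x 2] e_card[OF 2(1)])
      finally show ?thesis using p(2) d by simp
    qed
    obtain v where v: "v \<in> e i" "x v = mu i x" using mu_attained 2 by blast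
    have "push \<tau> x v = 0" if "1 \<le> \<tau>"
      unfolding p(3) using v that mu_le_1[OF x 2(1)] by simp
    then show ?thesis using topI[OF 2(1) pos out sum] v(1) by blast
  qed
  then show "push \<tau> x \<in> X" and "1 \<le> \<tau> \<Longrightarrow> push \<tau> x \<in> A" by auto
qed

lemma continuous_M: "continuous_on UNIV M"
  unfolding M_def by (intro continuous_intros) (auto intro: continuous_mu)

lemma continuous_push:
  assumes t: "continuous_on Z \<tau>" and d: "\<And>p. p \<in> Z \<Longrightarrow> den (\<tau> p) (snd p) \<noteq> 0"
  shows "continuous_on Z (\<lambda>p::'a::topological_space \<times> ('v \<Rightarrow> real). push (\<tau> p) (snd p))"
proof -
  have m: "continuous_on Z (\<lambda>p. min (mu i (snd p)) (\<tau> p))" if "i < N" for i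
    by (intro continuous_on_min t continuous_on_compose2[OF continuous_mu[OF that] continuous_on_snd]
        continuous_on_id) auto
  have m': "continuous_on Z (\<lambda>p. if v \<in> e i then min (mu i (snd p)) (\<tau> p) else 0)" if "i < N" for i v
    using m[OF that] by (cases "v \<in> e i") auto
  have dc: "continuous_on Z (\<lambda>p. den (\<tau> p) (snd p))"
    unfolding den_def by (intro continuous_intros m) auto
  show ?thesis
    unfolding push_def
    by (intro continuous_on_coordinatewise_then_product continuous_on_divide continuous_on_diff
        continuous_on_snd_apply continuous_on_sum m' dc) (use d in auto)
qed

text \<open>The homotopy extension property of \<open>A \<subseteq> X\<close>, with an explicit extension: a contraction of \<open>A\<close>
  extends to \<open>X\<close> by radial projection from the barycentres of the \<open>e i\<close>.\<close>

lemma extend_contraction: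
  assumes con: "contractible_space (top_of_set A)"
  obtains h a where "continuous_on ({0..1::real} \<times> X) h" "h ` ({0..1} \<times> X) \<subseteq> X"
    "\<And>x. x \<in> X \<Longrightarrow> h (0, x) = x" "\<And>t x. t \<in> {0..1} \<Longrightarrow> x \<in> A \<Longrightarrow> h (t, x) \<in> A"
    "\<And>x. x \<in> A \<Longrightarrow> h (1, x) = a"
proof -
  obtain a H where "continuous_map (prod_topology (top_of_set {0..1::real}) (top_of_set A)) (top_of_set A) H"
    and H0: "\<And>x. H (0, x) = x" and H1: "\<And>x. H (1, x) = a"
    using con unfolding contractible_space_def homotopic_with_def by auto
  then have Hc: "continuous_on ({0..1} \<times> A) H" and HA: "\<And>t x. t \<in> {0..1} \<Longrightarrow> x \<in> A \<Longrightarrow> H (t, x) \<in> A"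
    by (auto simp: image_subset_iff)
  \<comment> \<open>The cap \<open>t / (2 * (n + 1))\<close> grows with time and reaches
    \<open>mu i x\<close> when \<open>t\<close> equals \<open>2 * M x\<close>; from then on the
    boundary point follows the given contraction \<open>H\<close> with clock
    \<open>t - 2 * M x\<close>. Where \<open>M x\<close> exceeds 1/2, time 1 comes before the
    boundary is reached, which keeps barycentres away from \<open>push 1\<close>.\<close>
  define h where "h p = (if 2 * M (snd p) - fst p \<le> 0 then H (fst p - 2 * M (snd p), push 1 (snd p))
     else push (fst p / (2 * (n + 1))) (snd p))" for p
  let ?I = "{0..1::real} \<times> X"
  have Mc: "continuous_on Z (\<lambda>p::real \<times> ('v \<Rightarrow> real). M (snd p))" for Z
    by (rule continuous_on_compose2[OF continuous_M continuous_on_snd[OF continuous_on_id]]) simp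
  have half: "push 1 (snd p) \<in> A" "fst p - 2 * M (snd p) \<in> {0..1}" "den 1 (snd p) \<noteq> 0"
    if "p \<in> ?I" "2 * M (snd p) - fst p \<le> 0" for p
    using that push_X[of "snd p" 1] den_ge[of "snd p" 1] M_bounds(1)[of "snd p"] by auto
  have tau: "0 \<le> t / (2 * (n + 1))" "t / (2 * (n + 1)) \<le> 1 / (2 * (n + 1))" if "t \<in> {0..1}" for t :: real
    using that by (auto intro: divide_right_mono)
  have "continuous_on ?I h" unfolding h_def
  proof (rule continuous_on_cases_le)
    show "continuous_on ?I (\<lambda>p. 2 * M (snd p) - fst p)"
      by (intro continuous_intros Mc)
    show "continuous_on {p \<in> ?I. 2 * M (snd p) - fst p \<le> 0} (\<lambda>p. H (fst p - 2 * M (snd p), push 1 (snd p)))"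
    proof (rule continuous_on_compose2[OF Hc])
      show "continuous_on {p \<in> ?I. 2 * M (snd p) - fst p \<le> 0} (\<lambda>p. (fst p - 2 * M (snd p), push 1 (snd p)))"
        by (intro continuous_on_Pair continuous_on_diff continuous_on_mult continuous_on_const
            continuous_on_fst continuous_on_id Mc continuous_push) (use half in auto)
    qed (use half in auto)
    show "continuous_on {p \<in> ?I. 0 \<le> 2 * M (snd p) - fst p} (\<lambda>p. push (fst p / (2 * (n + 1))) (snd p))"
    proof (rule continuous_push)
      fix p assume "p \<in> {p \<in> ?I. 0 \<le> 2 * M (snd p) - fst p}"
      then have "1 / 2 \<le> den (fst p / (2 * (n + 1))) (snd p)"
        using tau[of "fst p"] by (intro den_ge) auto
      then show "den (fst p / (2 * (n + 1))) (snd p) \<noteq> 0" by linarith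
    qed (intro continuous_intros, simp)
    fix p assume p: "p \<in> ?I" "2 * M (snd p) - fst p = 0"
    then have x: "snd p \<in> X" by auto
    \<comment> \<open>On the seam the cap equals the sum of all \<open>mu i\<close>, so capping by
      it or by 1 has the same effect, and \<open>H\<close> is at time 0.\<close>
    have eq: "fst p / (2 * (n + 1)) = (\<Sum>i<N. mu i (snd p))"
      using p(2) by (simp add: M_def field_simps)
    have m: "min (mu i (snd p)) (fst p / (2 * (n + 1))) = min (mu i (snd p)) 1" if "i < N" for i
    proof -
      have "mu i (snd p) \<le> (\<Sum>i<N. mu i (snd p))"
        by (rule member_le_sum) (use that x mu_nonneg in auto)
      then show ?thesis unfolding eq using mu_le_1[OF x that] by simp
    qed
    have "(\<Sum>i<N. min (mu i (snd p)) (fst p / (2 * (n + 1)))) = (\<Sum>i<N. min (mu i (snd p)) 1)"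
      by (rule sum.cong[OF refl]) (rule m, simp)
    moreover have "(\<Sum>i<N. if v \<in> e i then min (mu i (snd p)) (fst p / (2 * (n + 1))) else 0)
        = (\<Sum>i<N. if v \<in> e i then min (mu i (snd p)) 1 else 0)" for v
      by (rule sum.cong[OF refl], rule if_cong[OF refl _ refl]) (rule m, simp)
    ultimately have "push (fst p / (2 * (n + 1))) (snd p) = push 1 (snd p)"
      unfolding push_def den_def by simp
    then show "H (fst p - 2 * M (snd p), push 1 (snd p)) = push (fst p / (2 * (n + 1))) (snd p)"
      using p H0 by auto
  qed
  moreover have "h (t, x) \<in> X" if "t \<in> {0..1}" "x \<in> X" for t x
    using half[of "(t, x)"] HA AX push_X(1)[OF that(2) tau(1)[OF that(1)]] tau(2)[OF that(1)] that
    unfolding h_def by auto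
  moreover have "h (0, x) = x" if "x \<in> X" for x
    using that
  proof (cases rule: X_cases)
    case 1
    then show ?thesis using M_A push_A H0 by (simp add: h_def)
  next
    case (2 i)
    have "0 < mu i x" using mu_pos_iff[OF that 2(1)] 2(2) by simp
    then have "0 < M x" using push_top(1)[OF that 2, of 1] by simp
    moreover have "push 0 x = x" using push_top(2,3)[OF that 2, of 0] mu_nonneg[OF that 2(1)] by auto
    ultimately show ?thesis by (simp add: h_def)
  qed
  moreover have "h (t, x) \<in> A" if "t \<in> {0..1}" "x \<in> A" for t x
    using that M_A push_A HA by (auto simp: h_def)
  moreover have "h (1, x) = a" if "x \<in> A" for x
    using that M_A push_A H1 by (auto simp: h_def)
  ultimately show ?thesis by (intro that[of h a]) auto
qed

text \<open>The inversion \<open>(m, w) \<mapsto> 2 m (m, w) / (m\<^sup>2 + |w|\<^sup>2)\<close> carries the half space \<open>m > 0\<close> onto the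
  sphere of radius 1 about \<open>(1, 0)\<close> without the origin. It is applied to the rescaled least
  barycentric coordinate \<open>m\<close> and to the vector \<open>w\<close> of all barycentric coordinates but one, centred
  at the barycentre; the summand \<open>(1 - s)\<^sup>2\<close> prevents a zero denominator off the simplex.\<close>

definition ht where "ht i x = (n + 1) * mu i x"
definition off where "off i x l = x (vx i l) - 1 / (n + 1)"
definition dn where "dn i x = (ht i x)\<^sup>2 + (\<Sum>l=1..n. (off i x l)\<^sup>2) + (1 - sum x (e i))\<^sup>2"
definition collapse where "collapse x j =
  (if j div (n + 1) < N then
    2 * ht (j div (n + 1)) x / dn (j div (n + 1)) x *
      (if j mod (n + 1) = 0 then ht (j div (n + 1)) x else off (j div (n + 1)) x (j mod (n + 1)))
   else 0)"

lemma sum_e: "i < N \<Longrightarrow> sum x (e i) = (\<Sum>l\<le>n. x (vx i l))"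
  by (rule sum.reindex_bij_betw[OF vx, symmetric])

lemma sum_atMost_split: "(\<Sum>l\<le>n. f l) = f 0 + (\<Sum>l=1..n. f l)" for f :: "nat \<Rightarrow> real"
proof -
  have "{..n} = insert 0 {1..n}" by auto
  then show ?thesis by simp
qed

text \<open>The offset of the dropped vertex 0 is thus minus the sum of the others, so
  \<open>collapse\<close> loses nothing by omitting it.\<close>

lemma sum_off: "i < N \<Longrightarrow> sum x (e i) = 1 \<Longrightarrow> (\<Sum>l\<le>n. off i x l) = 0"
  by (simp add: off_def sum_subtractf sum_e)

text \<open>A vanishing denominator would force mass 1 on \<open>e i\<close> and all offsets 0, so
  that \<open>x\<close> takes the value 1/(n+1) on all of \<open>e i\<close>; but then
  \<open>ht\<close> is positive, not 0.\<close>

lemma dn_pos: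
  assumes x: "x \<in> X" and i: "i < N"
  shows "0 < dn i x"
proof (rule ccontr)
  assume "\<not> 0 < dn i x"
  moreover have "0 \<le> (ht i x)\<^sup>2" "0 \<le> (\<Sum>l=1..n. (off i x l)\<^sup>2)" "0 \<le> (1 - sum x (e i))\<^sup>2"
    by (auto intro: sum_nonneg)
  ultimately have 0: "(ht i x)\<^sup>2 = 0" "(\<Sum>l=1..n. (off i x l)\<^sup>2) = 0" "(1 - sum x (e i))\<^sup>2 = 0"
    unfolding dn_def by linarith+
  from 0(2) have w: "off i x l = 0" if "l \<in> {1..n}" for l
    using that by (subst (asm) sum_nonneg_eq_0_iff) auto
  have "off i x 0 = 0"
    using sum_off[OF i, of x] 0(3) w by (simp add: sum_atMost_split)
  then have "off i x l = 0" if "l \<in> {..n}" for l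
    using w that by (cases "l = 0") auto
  then have "v \<in> supp x" if "v \<in> e i" for v
    using that by (auto simp: e_vx[OF i] off_def)
  then have "0 < mu i x" using mu_pos_iff[OF x i] by auto
  then show False using 0(1) by (simp add: ht_def)
qed

lemma collapse_coord:
  assumes "i < N" "l \<le> n"
  shows "collapse x (i * (n + 1) + l) = 2 * ht i x / dn i x * (if l = 0 then ht i x else off i x l)"
proof -
  have dm: "(i * (n + 1) + l) div (n + 1) = i" "(i * (n + 1) + l) mod (n + 1) = l"
    using assms(2) by (auto simp del: mult_Suc_right simp: div_mult_self3)
  show ?thesis unfolding collapse_def dm using assms(1) by simp
qed

lemma collapse_A: "x \<in> A \<Longrightarrow> collapse x = (\<lambda>_. 0)"
  by (rule ext) (auto simp: collapse_def ht_def mu_A)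

lemma collapse_other:
  assumes "x \<in> X" "i < N" "supp x = e i" "j \<notin> {i * (n + 1)..i * (n + 1) + n}"
  shows "collapse x j = 0"
proof (cases "j div (n + 1) < N")
  case True
  have "j div (n + 1) \<noteq> i"
  proof
    assume "j div (n + 1) = i"
    then have "j = i * (n + 1) + j mod (n + 1)" by (metis div_mult_mod_eq)
    moreover have "j mod (n + 1) \<le> n" using mod_less_divisor[of "n + 1" j] by linarith
    ultimately have "i * (n + 1) \<le> j" "j \<le> i * (n + 1) + n" by linarith+
    then show False using assms(4) by simp
  qed
  then show ?thesis using mu_other[OF assms(1-3) True] by (simp add: collapse_def ht_def)
qed (auto simp: collapse_def)

lemma continuous_collapse: "continuous_on X collapse"
proof -
  have mc: "continuous_on X (ht i)" if "i < N" for i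
    unfolding ht_def using continuous_on_subset[OF continuous_mu[OF that]] by (intro continuous_intros) auto
  have cc: "continuous_on X (\<lambda>x. x v)" for v
    by (rule continuous_on_subset[OF continuous_on_product_coordinates]) simp
  have oc: "continuous_on X (\<lambda>x. off i x l)" for i l
    unfolding off_def by (intro continuous_on_diff cc continuous_on_const)
  have dc: "continuous_on X (dn i)" if "i < N" for i
    unfolding dn_def
    by (intro continuous_on_add continuous_on_power continuous_on_sum continuous_on_diff cc oc
        continuous_on_const mc that)
  show ?thesis
  proof (rule continuous_on_coordinatewise_then_product)
    fix j
    show "continuous_on X (\<lambda>x. collapse x j)"
    proof (cases "j div (n + 1) < N")
      case True
      have "continuous_on X (\<lambda>x. if j mod (n + 1) = 0 then ht (j div (n + 1)) x
          else off (j div (n + 1)) x (j mod (n + 1)))"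
        using mc[OF True] oc by (cases "j mod (n + 1) = 0") auto
      then show ?thesis
        unfolding collapse_def if_P[OF True]
        by (intro continuous_on_mult continuous_on_divide continuous_on_const mc dc True)
          (metis dn_pos True less_irrefl)
    qed (simp add: collapse_def)
  qed
qed

lemma dn_top:
  assumes "x \<in> X" "i < N" "supp x = e i"
  shows "dn i x = (ht i x)\<^sup>2 + (\<Sum>l=1..n. (off i x l)\<^sup>2)" "0 < ht i x"
  using sum_top[OF assms] mu_pos_iff[OF assms(1,2)] assms(3) by (auto simp: dn_def ht_def)

text \<open>With \<open>m\<close> for \<open>ht i x\<close> and \<open>D\<close> for
  \<open>dn i x\<close>, in which the mass defect vanishes here, the image has first coordinate 2
  m^2 / D and squared length 4 m^2 / D. Squared length equal to twice the first coordinate is the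
  equation of the unit sphere through the origin.\<close>

lemma collapse_in_sphere:
  assumes x: "x \<in> X" "i < N" "supp x = e i"
  shows "collapse x \<in> wedge_sphere n i"
proof -
  let ?D = "dn i x" and ?m = "ht i x" and ?W = "\<Sum>l=1..n. (off i x l)\<^sup>2"
  have D: "?D = ?m\<^sup>2 + ?W" "0 < ?D" using dn_top[OF x] dn_pos[OF x(1,2)] by auto
  have "(\<Sum>j\<in>{i*(n+1)+1..i*(n+1)+n}. (collapse x j)\<^sup>2) = (\<Sum>l=1..n. (collapse x (i*(n+1)+l))\<^sup>2)"
    by (rule sum.reindex_bij_witness[of _ "\<lambda>l. i*(n+1)+l" "\<lambda>j. j - i*(n+1)"]) auto
  also have "\<dots> = (\<Sum>l=1..n. (2 * ?m / ?D)\<^sup>2 * (off i x l)\<^sup>2)"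
  proof (rule sum.cong[OF refl])
    fix l assume "l \<in> {1..n}"
    then show "(collapse x (i*(n+1)+l))\<^sup>2 = (2 * ?m / ?D)\<^sup>2 * (off i x l)\<^sup>2"
      using collapse_coord[OF x(2), of l x] by (simp add: power_mult_distrib power_divide)
  qed
  also have "\<dots> = (2 * ?m / ?D)\<^sup>2 * ?W" by (simp add: sum_distrib_left)
  finally have 1: "(\<Sum>j\<in>{i*(n+1)+1..i*(n+1)+n}. (collapse x j)\<^sup>2) = (2 * ?m / ?D)\<^sup>2 * ?W" .
  have 0: "collapse x (i*(n+1)) = 2 * ?m / ?D * ?m" using collapse_coord[OF x(2), of 0 x] by simp
  have "(2 * ?m / ?D * ?m - 1)\<^sup>2 + (2 * ?m / ?D)\<^sup>2 * ?W = 1"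
  proof -
    have "(2 * ?m / ?D * ?m - 1)\<^sup>2 + (2 * ?m / ?D)\<^sup>2 * ?W
      = (2 * ?m / ?D)\<^sup>2 * (?m\<^sup>2 + ?W) - 4 * ?m\<^sup>2 / ?D + 1"
      by (simp add: power2_eq_square algebra_simps)
    also have "\<dots> = 1" using D by (simp add: power2_eq_square flip: D(1))
    finally show ?thesis .
  qed
  then show ?thesis unfolding wedge_sphere_def
    using collapse_other[OF x] 0 1 by simp
qed

lemma collapse_top_nonzero:
  assumes x: "x \<in> X" "i < N" "supp x = e i"
  shows "0 < collapse x (i * (n + 1))"
  using collapse_coord[OF x(2), of 0 x] dn_top(2)[OF x] dn_pos[OF x(1,2)] by simp

text \<open>A zero image characterises \<open>A\<close>, and the block with nonzero first coordinate
  identifies the simplex. Dividing by that coordinate gives the ratios \<open>off / ht\<close>,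
  which fix the ray from the barycentre; the position on the ray is recovered from the smallest
  ratio.\<close>

lemma collapse_inj:
  assumes x: "x \<in> X" and y: "y \<in> X" and eq: "collapse x = collapse y"
  shows "x = y \<or> x \<in> A \<and> y \<in> A"
proof (cases "x \<in> A \<or> y \<in> A")
  case True
  have "z \<in> A" if "z \<in> X" "collapse z = (\<lambda>_. 0)" for z
    using that(1)
  proof (cases rule: X_cases)
    case (2 i)
    then show ?thesis using collapse_top_nonzero[OF that(1) 2] that(2) by simp
  qed
  then show ?thesis using True x y eq collapse_A by metis
next
  case False
  obtain i where i: "i < N" "supp x = e i" using X_cases[OF x] False by blast
  obtain i' where i': "i' < N" "supp y = e i'" using X_cases[OF y] False by blast
  have [simp]: "i' = i"
  proof (rule ccontr)
    assume "i' \<noteq> i"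
    then have "i * (n + 1) \<notin> {i' * (n + 1)..i' * (n + 1) + n}"
    proof (cases "i' < i")
      case True
      then have "(i' + 1) * (n + 1) \<le> i * (n + 1)" by (intro mult_right_mono) auto
      then show ?thesis by simp
    next
      case False
      then have "(i + 1) * (n + 1) \<le> i' * (n + 1)" using \<open>i' \<noteq> i\<close> by (intro mult_right_mono) auto
      then show ?thesis by simp
    qed
    then have "collapse y (i * (n + 1)) = 0" using collapse_other[OF y i'] by blast
    then show False using collapse_top_nonzero[OF x i] eq by simp
  qed
  have i': "supp y = e i" using i' by simp
  have mx: "0 < ht i x" and my: "0 < ht i y"
    using dn_top(2)[OF x i] dn_top(2)[OF y i(1) i'] by auto
  define c where "c = 2 * ht i x / dn i x * ht i x"
  have c: "c = collapse x (i * (n + 1))" using collapse_coord[OF i(1), of 0 x] by (simp add: c_def)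
  have cy: "c = 2 * ht i y / dn i y * ht i y"
    using collapse_coord[OF i(1), of 0 y] eq by (simp add: c)
  have c0: "0 < c" using c collapse_top_nonzero[OF x i] by simp
  have ratio1: "off i x l / ht i x = off i y l / ht i y" if "l \<in> {1..n}" for l
  proof -
    have "2 * ht i x / dn i x * off i x l = 2 * ht i y / dn i y * off i y l"
      using collapse_coord[OF i(1), of l x] collapse_coord[OF i(1), of l y] eq that by simp
    moreover have "2 * ht i x / dn i x * off i x l = c * (off i x l / ht i x)"
      using mx by (simp add: c_def)
    moreover have "2 * ht i y / dn i y * off i y l = c * (off i y l / ht i y)"
      using my by (simp add: cy)
    ultimately have "c * (off i x l / ht i x) = c * (off i y l / ht i y)" by metis
    then show ?thesis unfolding mult_cancel_left using c0 by linarith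
  qed
  have "off i z 0 / ht i z = - (\<Sum>l=1..n. off i z l / ht i z)" if "z \<in> X" "supp z = e i" for z
  proof -
    have "off i z 0 = - (\<Sum>l=1..n. off i z l)"
      using sum_off[OF i(1) sum_top[OF that(1) i(1) that(2)]] by (simp add: sum_atMost_split)
    then show ?thesis by (simp add: sum_divide_distrib)
  qed
  then have "off i x 0 / ht i x = off i y 0 / ht i y"
    using x y i(2) i' ratio1 by simp
  then have ratio: "off i x l / ht i x = off i y l / ht i y" if "l \<le> n" for l
    using ratio1[of l] that by (cases "l = 0") auto
  \<comment> \<open>At a minimal coordinate of \<open>z\<close> the offset equals
    \<open>(ht i z - 1) / (n + 1)\<close>, while that of \<open>w\<close> is at least the analogous
    value. Divided by \<open>ht\<close> this becomes \<open>(1 - 1 / ht) / (n + 1)\<close>, which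
    increases with \<open>ht\<close>.\<close>
  have le: "ht i w \<le> ht i z"
    if "0 < ht i z" "0 < ht i w" "\<And>l. l \<le> n \<Longrightarrow> off i z l / ht i z = off i w l / ht i w" for z w
  proof -
    obtain v where v: "v \<in> e i" "z v = mu i z" using mu_attained[OF i(1)] by blast
    then obtain l where l: "l \<le> n" "v = vx i l" by (auto simp: e_vx[OF i(1)])
    have ht_mu: "(ht i z - 1) / (n + 1) = mu i z - 1 / (n + 1)" for z
      by (simp add: ht_def diff_divide_distrib)
    have "off i z l = (ht i z - 1) / (n + 1)"
      unfolding ht_mu using v l by (simp add: off_def)
    moreover have "(ht i w - 1) / (n + 1) \<le> off i w l"
      unfolding ht_mu using mu_le[OF v(1) i(1), of w] l by (simp add: off_def)
    ultimately have "(ht i w - 1) / (n + 1) / ht i w \<le> (ht i z - 1) / (n + 1) / ht i z"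
      using that(3)[OF l(1)] that(2) by (metis divide_right_mono less_imp_le)
    then have "(ht i w - 1) / ht i w / (n + 1) \<le> (ht i z - 1) / ht i z / (n + 1)"
      by (simp only: divide_divide_eq_left mult.commute)
    then have "(ht i w - 1) / ht i w \<le> (ht i z - 1) / ht i z"
      by (subst (asm) divide_le_cancel) simp
    then show ?thesis using that(1,2) by (simp add: divide_simps algebra_simps)
  qed
  have "ht i x = ht i y" by (intro antisym le) (use mx my ratio in auto)
  then have "off i x l = off i y l" if "l \<le> n" for l using ratio[OF that] mx by simp
  then have "x v = y v" if "v \<in> e i" for v
    using that by (auto simp: e_vx[OF i(1)] off_def)
  moreover have "x v = 0" "y v = 0" if "v \<notin> e i" for v
    using that i(2) i' by auto
  ultimately have "x v = y v" for v by (cases "v \<in> e i") auto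
  then show ?thesis by blast
qed

lemma collapse_surj:
  assumes p: "p \<in> wedge_sphere n i" and i: "i < N" and p0: "p \<noteq> (\<lambda>_. 0)"
  obtains x where "x \<in> X" "collapse x = p"
proof -
  define p\<^sub>0 where "p\<^sub>0 = p (i * (n + 1))"
  define P where "P = (\<Sum>l=1..n. (p (i*(n+1)+l))\<^sup>2)"
  have P0: "0 \<le> P" unfolding P_def by (rule sum_nonneg) simp
  have out: "p j = 0" if "j \<notin> {i*(n+1)..i*(n+1)+n}" for j
    using p that unfolding wedge_sphere_def by blast
  have "(\<Sum>j\<in>{i*(n+1)+1..i*(n+1)+n}. (p j)\<^sup>2) = P"
    unfolding P_def
    by (rule sum.reindex_bij_witness[of _ "\<lambda>l. i*(n+1)+l" "\<lambda>j. j - i*(n+1)"]) auto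
  then have "(p\<^sub>0 - 1)\<^sup>2 + P = 1" using p by (simp add: wedge_sphere_def p\<^sub>0_def)
  then have sph: "p\<^sub>0\<^sup>2 + P = 2 * p\<^sub>0" by (simp add: power2_eq_square algebra_simps)
  then have "0 \<le> p\<^sub>0" using P0 by (smt (verit) zero_le_power2)
  moreover have "p\<^sub>0 \<noteq> 0"
  proof
    assume "p\<^sub>0 = 0"
    then have "P = 0" using sph by simp
    then have z: "p (i*(n+1)+l) = 0" if "l \<in> {1..n}" for l
      using that unfolding P_def by (subst (asm) sum_nonneg_eq_0_iff) auto
    have "p j = 0" for j
    proof (cases "j \<in> {i*(n+1)..i*(n+1)+n}")
      case True
      then obtain l where l: "j = i*(n+1) + l" "l \<le> n"
        by (metis atLeastAtMost_iff le_Suc_ex add_le_cancel_left)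
      then show ?thesis
        using z[of l] \<open>p\<^sub>0 = 0\<close> unfolding l(1) by (cases "l = 0") (auto simp: p\<^sub>0_def)
    qed (use out in blast)
    then show False using p0 by blast
  qed
  ultimately have pos: "0 < p\<^sub>0" by simp
  \<comment> \<open>These are the ratios \<open>off / ht\<close> that \<open>p\<close> prescribes;
    \<open>y\<close> adds the ratio at 0 so that all of them sum to 0.\<close>
  define u where "u l = p (i*(n+1)+l) / p\<^sub>0" for l
  define y where "y l = (if l = 0 then - (\<Sum>l=1..n. u l) else u l)" for l
  have sum_y: "(\<Sum>l\<le>n. y l) = 0" by (simp add: sum_atMost_split y_def)
  define b where "b = Min (y ` {..n})"
  have b_le: "b \<le> y l" if "l \<le> n" for l unfolding b_def using that by auto
  obtain l0 where l0: "l0 \<le> n" "b = y l0"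
  proof -
    have "b \<in> y ` {..n}" unfolding b_def by (rule Min_in) auto
    then show ?thesis using that by auto
  qed
  have b0: "b \<le> 0"
  proof -
    have "of_nat (card {..n}) * b \<le> (\<Sum>l\<le>n. y l)" by (rule sum_bounded_below) (use b_le in auto)
    then show ?thesis using sum_y by (simp add: mult_le_0_iff)
  qed
  \<comment> \<open>The value that \<open>ht\<close> must take: the least coordinate is to be
    \<open>m / (n + 1)\<close>, so the smallest ratio \<open>b\<close> has to equal
    \<open>(m - 1) / ((n + 1) * m)\<close>. Solving for \<open>m\<close> gives this, and
    \<open>b\<close> \<le> 0 makes it positive.\<close>
  define m where "m = 1 / (1 - (n + 1) * b)"
  have d1: "1 \<le> 1 - (n + 1) * b" using b0 by (simp add: mult_nonneg_nonpos)
  have m: "0 < m" "m * (1 - (n + 1) * b) = 1" using d1 by (auto simp: m_def)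
  then have mb: "1 + m * ((n + 1) * b) = m" by (simp add: algebra_simps)
  define ix where "ix = inv_into {..n} (vx i)"
  have ix: "ix (vx i l) = l" if "l \<le> n" for l
    unfolding ix_def using vx[OF i] that by (simp add: bij_betw_def)
  define x where "x v = (if v \<in> e i then 1 / (n + 1) + m * y (ix v) else 0)" for v
  have xv: "x (vx i l) = 1 / (n + 1) + m * y l" if "l \<le> n" for l
    using that ix by (simp add: x_def e_vx[OF i])
  have xmin: "x (vx i l0) = m / (n + 1)"
    unfolding xv[OF l0(1)] using mb l0(2) by (simp add: field_simps)
  have xge: "m / (n + 1) \<le> x v" if v: "v \<in> e i" for v
  proof -
    obtain l where l: "l \<le> n" "v = vx i l" using v by (auto simp: e_vx[OF i])
    have "m * b \<le> m * y l" using m b_le[OF l(1)] by simp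
    then show ?thesis using xmin xv[OF l(1)] xv[OF l0(1)] l l0 by simp
  qed
  have xpos: "0 < x v" if "v \<in> e i" for v
    using xge[OF that] m by (smt (verit) divide_pos_pos of_nat_0_less_iff zero_less_Suc Suc_eq_plus1)
  have xsum: "sum x (e i) = 1"
    unfolding sum_e[OF i] by (simp add: xv sum.distrib sum_distrib_left[symmetric] sum_y)
  have xX: "x \<in> X"
  proof (rule topI[OF i _ _ xsum])
    show "0 \<le> x v" for v using xpos[of v] by (cases "v \<in> e i") (auto simp: x_def)
  qed (simp add: x_def)
  have "x v \<noteq> 0 \<longleftrightarrow> v \<in> e i" for v
    using less_imp_neq[OF xpos[of v]] by (cases "v \<in> e i") (auto simp: x_def)
  then have xs: "supp x = e i" by auto
  have "mu i x = m / (n + 1)"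
    unfolding mu_def
  proof (rule Min_eqI)
    show "m / (n + 1) \<in> x ` e i" using xmin l0(1) by (metis e_vx[OF i] atMost_iff imageI)
  qed (use xge e_fin[OF i] in auto)
  then have hx: "ht i x = m" by (simp add: ht_def)
  have ofx: "off i x l = m * u l" if "l \<in> {1..n}" for l
    using that xv[of l] by (simp add: off_def y_def)
  have U: "1 + (\<Sum>l=1..n. (u l)\<^sup>2) = 2 / p\<^sub>0"
  proof -
    have "(\<Sum>l=1..n. (u l)\<^sup>2) = P / p\<^sub>0\<^sup>2"
      by (simp add: u_def P_def power_divide sum_divide_distrib)
    also have "\<dots> = 2 / p\<^sub>0 - 1"
      using sph pos by (simp add: field_simps power2_eq_square)
    finally show ?thesis by simp
  qed
  have dx: "dn i x = m\<^sup>2 * (2 / p\<^sub>0)"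
  proof -
    have "(\<Sum>l=1..n. (off i x l)\<^sup>2) = (\<Sum>l=1..n. m\<^sup>2 * (u l)\<^sup>2)"
      by (rule sum.cong[OF refl]) (simp only: ofx power_mult_distrib)
    also have "\<dots> = m\<^sup>2 * (\<Sum>l=1..n. (u l)\<^sup>2)" by (simp only: sum_distrib_left)
    finally have "dn i x = m\<^sup>2 * (1 + (\<Sum>l=1..n. (u l)\<^sup>2))"
      using dn_top(1)[OF xX i xs] hx by (simp only: distrib_left mult_1_right)
    then show ?thesis unfolding U .
  qed
  have fac: "2 * ht i x / dn i x = p\<^sub>0 / m"
    unfolding hx dx using pos m by (simp add: power2_eq_square)
  have "collapse x j = p j" for j
  proof (cases "j \<in> {i*(n+1)..i*(n+1)+n}")
    case True
    define l where "l = j - i*(n+1)"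
    have l: "l \<le> n" "j = i*(n+1) + l" using True by (auto simp: l_def)
    have cc: "collapse x j = p\<^sub>0 / m * (if l = 0 then m else off i x l)"
      using collapse_coord[OF i l(1), of x] unfolding fac l(2)[symmetric] unfolding hx .
    show ?thesis
    proof (cases "l = 0")
      case True
      then show ?thesis unfolding cc using m l(2) by (simp add: p\<^sub>0_def)
    next
      case False
      then have "off i x l = m * u l" using ofx l(1) by simp
      then show ?thesis unfolding cc using m(1) pos False by (simp add: u_def l(2))
    qed
  qed (use out collapse_other[OF xX i xs] in simp)
  then show ?thesis using that xX by blast
qed

lemma collapse_image:
  assumes "A \<noteq> {}"
  shows "collapse ` X = wedge_of_spheres N n"
proof
  show "collapse ` X \<subseteq> wedge_of_spheres N n"
  proof
    fix p assume "p \<in> collapse ` X"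
    then obtain x where x: "x \<in> X" "p = collapse x" by auto
    from x(1) show "p \<in> wedge_of_spheres N n"
    proof (cases rule: X_cases)
      case 1
      then show ?thesis using x collapse_A by (simp add: wedge_of_spheres_def)
    next
      case (2 i)
      then show ?thesis using collapse_in_sphere[OF x(1) 2] x(2) by (auto simp: wedge_of_spheres_def)
    qed
  qed
  obtain a where "a \<in> A" using assms by blast
  then have 0: "(\<lambda>_. 0) \<in> collapse ` X" using AX collapse_A[of a] by (auto intro!: image_eqI[of _ _ a])
  show "wedge_of_spheres N n \<subseteq> collapse ` X"
  proof
    fix p assume "p \<in> wedge_of_spheres N n"
    then consider "p = (\<lambda>_. 0)" | i where "i < N" "p \<in> wedge_sphere n i" "p \<noteq> (\<lambda>_. 0)"
      unfolding wedge_of_spheres_def by blast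
    then show "p \<in> collapse ` X"
    proof cases
      case 2
      obtain x where "x \<in> X" "collapse x = p" using collapse_surj[OF 2(2,1,3)] .
      then show ?thesis by blast
    qed (use 0 in simp)
  qed
qed

lemma homotopy_equivalent_wedge:
  assumes "contractible_space (top_of_set A)" "A \<noteq> {}"
  shows "top_of_set X homotopy_equivalent_space top_of_set (wedge_of_spheres N n)"
proof -
  obtain h a where h: "continuous_on ({0..1::real} \<times> X) h" "h ` ({0..1} \<times> X) \<subseteq> X"
    "\<And>x. x \<in> X \<Longrightarrow> h (0, x) = x" "\<And>t x. t \<in> {0..1} \<Longrightarrow> x \<in> A \<Longrightarrow> h (t, x) \<in> A"
    "\<And>x. x \<in> A \<Longrightarrow> h (1, x) = a"
    using extend_contraction[OF assms(1)] by blast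
  have "top_of_set X homotopy_equivalent_space top_of_set (collapse ` X)"
    by (rule collapse_homotopy_equivalent[OF compact_X AX continuous_collapse collapse_inj collapse_A h])
  then show ?thesis using collapse_image[OF assms(2)] by simp
qed

end

subsection \<open>The homotopy type of a shellable complex\<close>

lemma geom_realization_nonempty:
  assumes "G \<in> K" "finite G" "G \<noteq> {}"
  shows "geom_realization K \<noteq> {}"
proof -
  define x where "x v = (if v \<in> G then 1 / card G else 0 :: real)" for v
  have "{v. x v \<noteq> 0} = G" using assms by (auto simp: x_def)
  then have "x \<in> geom_realization K"
    using assms by (intro geom_realizationI[of G]) (auto simp: x_def)
  then show ?thesis by blast
qed

lemma shelling_homotopy_equivalent_wedge:
  fixes K :: "'v set set"
  assumes fin: "finite K" "\<And>G. G \<in> K \<Longrightarrow> finite G \<and> G \<noteq> {}" and ne: "K \<noteq> {}"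
    and down: "\<And>G G'. G \<in> K \<Longrightarrow> G' \<subseteq> G \<Longrightarrow> G' \<noteq> {} \<Longrightarrow> G' \<in> K"
    and pure: "pure_card K m" and fs: "distinct fs" "set fs = facets K"
    and shelling: "\<And>j. 0 < j \<Longrightarrow> j < length fs \<Longrightarrow>
      pure_card {G. G \<subseteq> fs ! j \<and> (\<exists>i<j. G \<subseteq> fs ! i)} (m - 1)"
  shows "\<exists>N. top_of_set (geom_realization K) homotopy_equivalent_space top_of_set (wedge_of_spheres N (m - 1))"
proof -
  define F where "F j = fs ! j" for j
  \<comment> \<open>The restriction of the facet: for \<open>j\<close> > 0 the faces of
    \<open>F j\<close> that lie in no earlier facet are exactly those containing \<open>R j\<close>.
    So \<open>R j = F j\<close> means that only the facet itself is new.\<close>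
  define R where "R j = {v \<in> F j. \<exists>i<j. F j - {v} \<subseteq> F i}" for j
  define Hs where "Hs = F ` {j. j < length fs \<and> R j = F j}"
  define L where "L j = {G. G \<noteq> {} \<and> (\<exists>i<j. G \<subseteq> F i) \<and> G \<notin> Hs}" for j
  have Ffac: "F j \<in> facets K" if "j < length fs" for j
    using nth_mem[OF that] fs(2) by (simp add: F_def)
  have FK: "F j \<in> K" "finite (F j)" "F j \<noteq> {}" "card (F j) = m" if "j < length fs" for j
  proof -
    show "F j \<in> K" using Ffac[OF that] by (simp add: facets_def)
    then show "finite (F j)" "F j \<noteq> {}" using fin(2) by blast+
    show "card (F j) = m" using Ffac[OF that] pure by (simp add: pure_card_def)
  qed
  have Fmax: "F j = G" if "j < length fs" "G \<in> K" "F j \<subseteq> G" for j G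
    using Ffac[OF that(1)] that(2,3) unfolding facets_def by blast
  have HsF: "Hs \<subseteq> facets K" using Ffac by (auto simp: Hs_def)
  have not_Hs: "G \<notin> Hs" if "j < length fs" "G \<subset> F j" for j G
    using that(2) HsF FK(1)[OF that(1)] unfolding facets_def by blast
  have F_in_Hs: "F j \<in> Hs \<longleftrightarrow> R j = F j" if "j < length fs" for j
    using that nth_eq_iff_index_eq[OF fs(1)] unfolding Hs_def F_def by auto
  have m: "0 < m" if "j < length fs" for j using FK[OF that] by (metis card_gt_0_iff)
  have missing: "\<exists>v\<in>R j. v \<notin> G" if j: "0 < j" "j < length fs" and G: "G \<subseteq> F j" "i < j" "G \<subseteq> F i" for i j G
  proof -
    let ?C = "{G. G \<subseteq> fs ! j \<and> (\<exists>i<j. G \<subseteq> fs ! i)}"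
    have "G \<in> ?C" using G by (auto simp: F_def)
    then obtain H where H: "H \<in> facets ?C" "G \<subseteq> H" "card H = m - 1"
      using shelling[OF j] unfolding pure_card_def by blast
    then have HF: "H \<subseteq> F j" "\<exists>i<j. H \<subseteq> F i" by (auto simp: facets_def F_def)
    have "H \<noteq> F j" using H(3) FK(4)[OF j(2)] m[OF j(2)] by auto
    then obtain v where v: "v \<in> F j" "v \<notin> H" using HF by blast
    have "H = F j - {v}"
      by (rule card_subset_eq) (use FK[OF j(2)] H(3) HF v in auto)
    then show ?thesis using v HF H(2) by (auto simp: R_def)
  qed
  \<comment> \<open>The intersection complex of a shelling contains the empty face, so
    \<open>missing\<close> applies to it. In dimension 0 this puts every facet after the first into
    \<open>Hs\<close>.\<close>
  have R_ne: "R j \<noteq> {}" if "0 < j" "j < length fs" for j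
    using missing[OF that, of "{}" 0] that by auto
  have con: "contractible_space (top_of_set (geom_realization (L j)))" if "0 < j" "j \<le> length fs" for j
    using that
  proof (induction j rule: nat_induct_non_zero)
    case 1
    then have 0: "0 < length fs" by linarith
    have "R 0 = {}" by (simp add: R_def)
    then have "F 0 \<notin> Hs" using F_in_Hs[OF 0] FK(3)[OF 0] by auto
    then have "L 1 = Pow (F 0) - {{}}"
      using not_Hs[OF 0] by (auto simp: L_def)
    then show ?case using contractible_realization_simplex FK[OF 0] by simp
  next
    case (Suc j)
    then have j: "0 < j" "j < length fs" by auto
    have IH: "contractible_space (top_of_set (geom_realization (L j)))" using Suc by simp
    have early: "G \<in> L j" if "v \<in> R j" "G \<subseteq> F j - {v}" "G \<noteq> {}" for v G
      using that not_Hs[OF j(2), of G] unfolding L_def R_def by blast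
    show ?case
    proof (cases "R j = F j")
      case True
      have "G \<in> L j" if G: "G \<noteq> {}" "G \<subseteq> F j" "G \<notin> Hs" for G
      proof -
        have "G \<noteq> F j" using F_in_Hs[OF j(2)] True G(3) by auto
        then obtain v where v: "v \<in> F j" "v \<notin> G" using G(2) by blast
        show ?thesis
          by (rule early[of v]) (use v True G in auto)
      qed
      then have "L (Suc j) = L j" by (auto simp: L_def less_Suc_eq)
      then show ?thesis using IH by simp
    next
      case False
      then have RF: "R j \<subset> F j" by (auto simp: R_def)
      have "G \<notin> Hs" if "G \<subseteq> F j" for G
        using that not_Hs[OF j(2), of G] F_in_Hs[OF j(2)] False by (cases "G = F j") auto
      then have "L (Suc j) = L j \<union> (Pow (F j) - {{}})" by (auto simp: L_def less_Suc_eq)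
      moreover have "contractible_space (top_of_set (geom_realization (L j \<union> (Pow (F j) - {{}}))))"
      proof (rule contractible_realization_attach[OF FK(2)[OF j(2)] RF R_ne[OF j] early _ IH])
        fix G assume "G \<in> L j"
        then obtain i where i: "i < j" "G \<subseteq> F i" by (auto simp: L_def)
        show "\<not> R j \<subseteq> G" using missing[OF j, of "R j" i] RF i by auto
      qed
      ultimately show ?thesis by simp
    qed
  qed
  define n where "n = m - 1"
  define N where "N = card Hs"
  have finHs: "finite Hs" by (simp add: Hs_def)
  obtain e where e: "bij_betw e {..<N} Hs"
    using ex_bij_betw_nat_finite[OF finHs] by (auto simp: N_def atLeast0LessThan)
  have eHs: "\<exists>j<length fs. e i = F j" if "i < N" for i
  proof -
    have "e i \<in> Hs" using bij_betwE[OF e] that by blast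
    then show ?thesis unfolding Hs_def by blast
  qed
  have "\<exists>f. bij_betw f {..n} (e i)" if i: "i < N" for i
  proof -
    obtain j where j: "j < length fs" "e i = F j" using eHs[OF i] by blast
    have "{0..<m} = {..n}" using m[OF j(1)] by (auto simp: n_def)
    then show ?thesis
      using ex_bij_betw_nat_finite[OF FK(2)[OF j(1)]] unfolding FK(4)[OF j(1)] j(2) by simp
  qed
  then obtain vx where vx: "\<And>i. i < N \<Longrightarrow> bij_betw (vx i) {..n} (e i)" by metis
  define len where "len = length fs"
  have "facets K \<noteq> {}" using ne pure by (auto simp: pure_card_def)
  then have len: "0 < len" using fs(2) by (auto simp: len_def)
  have LK: "L len \<subseteq> K" using FK(1) down by (auto simp: L_def len_def)
  have Keq: "K = L len \<union> e ` {..<N}"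
  proof -
    have "e ` {..<N} = Hs" using e by (simp add: bij_betw_def)
    moreover have "G \<in> L len" if "G \<in> K" "G \<notin> Hs" for G
    proof -
      obtain H where H: "H \<in> facets K" "G \<subseteq> H" using pure \<open>G \<in> K\<close> by (auto simp: pure_card_def)
      then obtain j where "j < len" "H = F j" 
        unfolding fs(2)[symmetric] len_def F_def in_set_conv_nth by blast
      then show ?thesis unfolding L_def using H(2) that(2) fin(2)[OF that(1)] by blast
    qed
    moreover have "Hs \<subseteq> K" using HsF by (auto simp: facets_def)
    ultimately show ?thesis using LK by blast
  qed
  interpret top_simplices "L len" N n e vx
  proof
    show "finite (L len)" using LK fin(1) by (rule finite_subset)
    show "finite G" if "G \<in> L len" for G using that LK fin(2) by blast
    show "G' \<in> L len" if G: "G \<in> L len" "G' \<subseteq> G" "G' \<noteq> {}" for G G'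
    proof -
      obtain i where i: "i < len" "G \<subseteq> F i" using G(1) by (auto simp: L_def)
      have "G' \<notin> Hs"
      proof
        assume h: "G' \<in> Hs"
        then have "G' = G" using G(1,2) LK HsF unfolding facets_def by blast
        then show False using h G(1) by (auto simp: L_def)
      qed
      then show ?thesis unfolding L_def using G(3) order_trans[OF G(2) i(2)] i(1) by blast
    qed
    show "inj_on e {..<N}" using e by (simp add: bij_betw_def)
    show "G \<in> L len" if G: "i < N" "G \<subset> e i" "G \<noteq> {}" for i G
    proof -
      obtain j where j: "j < length fs" "e i = F j" using eHs[OF G(1)] by blast
      show ?thesis
        unfolding L_def len_def using j G(2,3) not_Hs[OF j(1), of G] by auto
    qed
    show "\<not> e i \<subseteq> G" if i: "i < N" "G \<in> L len" for i G
    proof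
      assume "e i \<subseteq> G"
      then have "e i = G" using eHs[OF i(1)] Fmax LK i(2) by blast
      then have "G \<in> Hs" using bij_betwE[OF e] i(1) by blast
      then show False using i(2) by (auto simp: L_def)
    qed
  qed (fact vx)
  have "F 0 \<notin> Hs" using F_in_Hs[of 0] len FK(3)[of 0] by (auto simp: len_def R_def)
  then have "F 0 \<in> L len" using len FK(3)[of 0] by (auto simp: L_def len_def)
  then have "A \<noteq> {}" unfolding A_def
    by (rule geom_realization_nonempty) (use FK[of 0] len in \<open>auto simp: len_def\<close>)
  moreover have "contractible_space (top_of_set A)"
    unfolding A_def using con[of len] len by (simp add: len_def)
  ultimately have "top_of_set X homotopy_equivalent_space top_of_set (wedge_of_spheres N n)"
    by (intro homotopy_equivalent_wedge)
  then show ?thesis unfolding X_def Keq[symmetric] n_def by blast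
qed

subsection \<open>Chordal building sets\<close>

locale chordal_building_set =
  fixes S :: "nat set" and B :: "nat set set"
  assumes bs: "building_set S B" and chordal: "chordal B"
begin

section \<open>Components and their parities\<close>

definition comps where "comps y = bs_components (bs_restrict B y)"
definition P where "P = P_hat S B"

lemma fin_S: "finite S" and B_ne: "I \<in> B \<Longrightarrow> I \<noteq> {}" and B_sub: "I \<in> B \<Longrightarrow> I \<subseteq> S"
    and B_sing: "i \<in> S \<Longrightarrow> {i} \<in> B" and B_un: "I \<in> B \<Longrightarrow> J \<in> B \<Longrightarrow> I \<inter> J \<noteq> {} \<Longrightarrow> I \<union> J \<in> B"
  using bs unfolding building_set_def by auto

lemma B_fin: "I \<in> B \<Longrightarrow> finite I"
  using B_sub fin_S finite_subset by blast

lemma comps_iff: "C \<in> comps y \<longleftrightarrow> C \<in> B \<and> C \<subseteq> y \<and> (\<forall>J\<in>B. J \<subseteq> y \<longrightarrow> C \<subseteq> J \<longrightarrow> J = C)"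
  by (auto simp: comps_def bs_components_def bs_restrict_def)

lemma compsD: "C \<in> comps y \<Longrightarrow> C \<in> B" "C \<in> comps y \<Longrightarrow> C \<subseteq> y"
  by (auto simp: comps_iff)

lemma comps_absorb: "C \<in> comps y \<Longrightarrow> J \<in> B \<Longrightarrow> J \<subseteq> y \<Longrightarrow> J \<inter> C \<noteq> {} \<Longrightarrow> J \<subseteq> C"
proof -
  assume C: "C \<in> comps y" and J: "J \<in> B" "J \<subseteq> y" "J \<inter> C \<noteq> {}"
  have "J \<union> C \<in> B" by (rule B_un) (use C J in \<open>auto simp: comps_iff\<close>)
  then have "J \<union> C = C" using C J by (auto simp: comps_iff)
  then show "J \<subseteq> C" by blast
qed

lemma comps_eq: "C \<in> comps y \<Longrightarrow> D \<in> comps y \<Longrightarrow> C \<inter> D \<noteq> {} \<Longrightarrow> C = D"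
  using comps_absorb[of C y D] comps_absorb[of D y C] compsD[of C y] compsD[of D y] by blast

lemma comps_mono: "C \<in> comps z \<Longrightarrow> z \<subseteq> y \<Longrightarrow> D \<in> comps y \<Longrightarrow> C \<inter> D \<noteq> {} \<Longrightarrow> C \<subseteq> D"
  using comps_absorb[of D y C] compsD[of C z] by blast

lemma comps_shrink: "C \<in> comps y \<Longrightarrow> z \<subseteq> y \<Longrightarrow> C \<subseteq> z \<Longrightarrow> C \<in> comps z"
  unfolding comps_iff by blast

definition cm where "cm y a = \<Union>{J \<in> B. J \<subseteq> y \<and> a \<in> J}"

lemma cm_comps:
  assumes "y \<subseteq> S" "a \<in> y"
  shows "cm y a \<in> comps y" "a \<in> cm y a"
proof -
  have "{a} \<in> B" using B_sing assms by auto
  then show a: "a \<in> cm y a" using assms by (auto simp: cm_def)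
  have "finite \<J> \<Longrightarrow> \<J> \<noteq> {} \<Longrightarrow> \<J> \<subseteq> {J \<in> B. J \<subseteq> y \<and> a \<in> J} \<Longrightarrow> \<Union>\<J> \<in> B" for \<J>
  proof (induction \<J> rule: finite_ne_induct)
    case (insert J \<J>)
    then have "J \<inter> \<Union>\<J> \<noteq> {}" by blast
    then show ?case using insert B_un[of J "\<Union>\<J>"] by auto
  qed auto
  moreover have "finite {J \<in> B. J \<subseteq> y \<and> a \<in> J}"
    by (rule finite_subset[of _ "Pow S"]) (use B_sub fin_S in auto)
  moreover have "{J \<in> B. J \<subseteq> y \<and> a \<in> J} \<noteq> {}" using \<open>{a} \<in> B\<close> assms by blast
  ultimately have "cm y a \<in> B" unfolding cm_def by blast
  then show "cm y a \<in> comps y" unfolding comps_iff using a by (auto simp: cm_def)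
qed

lemma cm_eq: "C \<in> comps y \<Longrightarrow> a \<in> C \<Longrightarrow> cm y a = C"
  using comps_absorb[of C y] compsD[of C y] unfolding cm_def by blast

lemma P_iff: "y \<in> P \<longleftrightarrow> y \<subseteq> S \<and> (\<forall>C\<in>comps y. even (card C))"
  by (simp add: P_def P_hat_def comps_def)

lemma P_sub: "y \<in> P \<Longrightarrow> y \<subseteq> S" and P_fin: "y \<in> P \<Longrightarrow> finite y"
  using finite_subset[OF _ fin_S, of y] by (auto simp: P_iff)

lemma empty_P: "{} \<in> P"
  using B_ne by (auto simp: P_iff comps_iff)

lemma even_card_Union_comps:
  assumes "\<C> \<subseteq> comps y" "y \<subseteq> S" "\<And>C. C \<in> \<C> \<Longrightarrow> even (card C)"
  shows "even (card (\<Union>\<C>))"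
proof -
  have "card (\<Union>\<C>) = sum card \<C>"
  proof (rule card_Union_disjoint)
    show "disjoint \<C>" unfolding disjoint_def pairwise_def disjnt_def using assms(1) comps_eq by blast
    show "finite C" if "C \<in> \<C>" for C using that assms(1) compsD B_fin by blast
  qed
  then show ?thesis using assms(3) by (simp add: dvd_sum)
qed

lemma comp_Int:
  assumes "C \<in> comps y" "z \<subseteq> y" "y \<subseteq> S"
  shows "C \<inter> z = \<Union>{D \<in> comps z. D \<subseteq> C}"
proof
  show "C \<inter> z \<subseteq> \<Union>{D \<in> comps z. D \<subseteq> C}"
  proof
    fix a assume a: "a \<in> C \<inter> z"
    have z: "z \<subseteq> S" using assms by auto
    have "cm z a \<in> comps z" "a \<in> cm z a" using cm_comps[OF z] a by auto
    then have "cm z a \<subseteq> C" using comps_mono[OF _ assms(2,1)] a by blast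
    then show "a \<in> \<Union>{D \<in> comps z. D \<subseteq> C}" using cm_comps[OF z] a by blast
  qed
qed (use compsD in blast)

text \<open>Components of \<open>z\<close> refine those of \<open>y\<close>, so the intersection is
  a disjoint union of components of \<open>z\<close>, each even.\<close>

lemma even_card_comp_Int:
  assumes "C \<in> comps y" "z \<subseteq> y" "y \<subseteq> S" "z \<in> P"
  shows "even (card (C \<inter> z))"
  unfolding comp_Int[OF assms(1-3)]
  by (rule even_card_Union_comps[of _ z]) (use assms in \<open>auto simp: P_iff\<close>)

lemma P_even: "y \<in> P \<Longrightarrow> even (card y)"
proof -
  assume y: "y \<in> P"
  have "y \<subseteq> \<Union>(comps y)" using cm_comps[OF P_sub[OF y]] by blast
  moreover have "\<Union>(comps y) \<subseteq> y" using compsD(2) by blast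
  ultimately have "y = \<Union>(comps y)" by blast
  then show ?thesis
    using even_card_Union_comps[of "comps y" y] y unfolding P_iff by auto
qed

text \<open>\<open>chordal\<close> speaks only of suffixes starting strictly between minimum and
  maximum. The suffix here starts at the successor \<open>j\<close> of \<open>d\<close>, which lies
  above the minimum; if \<open>j\<close> is the maximum, the suffix is a singleton.\<close>

lemma suffix_B:
  assumes C: "C \<in> B" and d: "d \<in> C" and ne: "{e \<in> C. d < e} \<noteq> {}"
  shows "{e \<in> C. d < e} \<in> B"
proof -
  have fin: "finite C" using B_fin C by blast
  define j where "j = Min {e \<in> C. d < e}"
  have "j \<in> {e \<in> C. d < e}" unfolding j_def by (rule Min_in) (use fin ne in auto)
  then have j: "j \<in> C" "d < j" by auto
  have le: "j \<le> e" if "e \<in> C" "d < e" for e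
    unfolding j_def using that fin by auto
  have eq: "{e \<in> C. d < e} = {e \<in> C. j \<le> e}" using le j by auto
  show ?thesis
  proof (cases "j < Max C")
    case True
    have "Min C < j" using Min_le[OF fin d] j by linarith
    then show ?thesis using chordal C j True unfolding chordal_def eq by blast
  next
    case False
    then have "{e \<in> C. j \<le> e} = {j}" using j(1) Max_ge[OF fin] by fastforce
    moreover have "{j} \<in> B" using B_sing B_sub C j(1) by blast
    ultimately show ?thesis using eq by simp
  qed
qed

section \<open>Two-element removals that stay in the poset\<close>

definition lowest2 :: "nat set \<Rightarrow> nat set \<Rightarrow> nat \<Rightarrow> nat \<Rightarrow> bool" where
  "lowest2 C x a b \<longleftrightarrow> a < b \<and> a \<in> C - x \<and> b \<in> C - x \<and> (\<forall>e\<in>C - x. e = a \<or> e = b \<or> b < e)"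

text \<open>Let \<open>U\<close> be the part of \<open>C\<close> above \<open>b\<close>. A component
  of \<open>y - {a, b}\<close> that misses \<open>U\<close> is either disjoint from
  \<open>C\<close>, hence a component of \<open>y\<close>, or lies in \<open>C\<close>. In the
  latter case it lies in \<open>x\<close>, which contains everything of \<open>C\<close> up to
  \<open>b\<close> except \<open>a\<close> and \<open>b\<close>, and is a component of
  \<open>x\<close>. At most one component remains, the one containing the connected set
  \<open>U\<close>; it is even because \<open>C - {a, b}\<close> has even size.\<close>

lemma remove_lowest2:
  assumes x: "x \<in> P" and y: "y \<in> P" and xy: "x \<subseteq> y" and C: "C \<in> comps y" and l2: "lowest2 C x a b"
  shows "y - {a, b} \<in> P"
  unfolding P_iff
proof (intro conjI ballI)
  have yS: "y \<subseteq> S" using P_sub y by blast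
  show "y - {a, b} \<subseteq> S" using yS by blast
  let ?y = "y - {a, b}"
  define U where "U = {e \<in> C. b < e}"
  have ab: "a \<in> C" "b \<in> C" "a \<notin> x" "b \<notin> x" "a \<noteq> b" "a < b" using l2 by (auto simp: lowest2_def)
  have low: "e \<in> x" if "e \<in> C" "\<not> b < e" "e \<noteq> a" "e \<noteq> b" for e
    using l2 that by (auto simp: lowest2_def)
  have even_disj: "even (card T)" if T: "T \<in> comps ?y" and UT: "U \<inter> T = {}" for T
  proof (cases "T \<inter> C = {}")
    case True
    have "T \<in> comps y"
      unfolding comps_iff
    proof (intro conjI ballI impI)
      show "T \<in> B" "T \<subseteq> y" using compsD[OF T] by auto
      fix J assume J: "J \<in> B" "J \<subseteq> y" "T \<subseteq> J"
      have "J \<inter> C = {}"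
      proof (rule ccontr)
        assume "J \<inter> C \<noteq> {}"
        then have "T \<subseteq> C" using comps_absorb[OF C J(1,2)] J(3) by blast
        then show False using True B_ne compsD(1)[OF T] by blast
      qed
      then have "J \<subseteq> ?y" using J ab by blast
      then show "J = T" using T J unfolding comps_iff by blast
    qed
    then show ?thesis using y by (simp add: P_iff)
  next
    case False
    then have TC: "T \<subseteq> C" using comps_mono[OF T _ C] by blast
    have "T \<subseteq> x"
    proof
      fix e assume e: "e \<in> T"
      then have "e \<in> C" "e \<noteq> a" "e \<noteq> b" "\<not> b < e" using TC compsD(2)[OF T] UT by (auto simp: U_def)
      then show "e \<in> x" using low by blast
    qed
    moreover have "x \<subseteq> ?y" using xy ab by blast
    ultimately have "T \<in> comps x" using comps_shrink[OF T] by blast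
    then show ?thesis using x by (simp add: P_iff)
  qed
  fix T assume T: "T \<in> comps ?y"
  show "even (card T)"
  proof (cases "U \<inter> T = {}")
    case False
    then have "U \<in> B" unfolding U_def using suffix_B[of C b] compsD(1)[OF C] ab(2) by blast
    moreover have "U \<subseteq> ?y" using compsD(2)[OF C] ab by (auto simp: U_def)
    ultimately have UT: "U \<subseteq> T" using comps_absorb[OF T] False by blast
    have TC: "T \<subseteq> C" using comps_mono[OF T _ C] False by (auto simp: U_def)
    have "C \<inter> ?y = \<Union>{D \<in> comps ?y. D \<subseteq> C}" by (rule comp_Int[OF C]) (use yS in auto)
    also have "\<dots> = T \<union> \<Union>({D \<in> comps ?y. D \<subseteq> C} - {T})" using T TC by blast
    finally have eq: "C \<inter> ?y = T \<union> \<Union>({D \<in> comps ?y. D \<subseteq> C} - {T})" .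
    have dis: "D \<inter> T = {}" if "D \<in> {D \<in> comps ?y. D \<subseteq> C} - {T}" for D
      using that comps_eq T by blast
    have fin: "finite (C \<inter> ?y)" using B_fin compsD(1)[OF C] by blast
    have "card (C \<inter> ?y) = card T + card (\<Union>({D \<in> comps ?y. D \<subseteq> C} - {T}))"
      unfolding eq by (rule card_Un_disjoint) (use fin eq dis in \<open>auto intro: finite_subset\<close>)
    moreover have "even (card (\<Union>({D \<in> comps ?y. D \<subseteq> C} - {T})))"
    proof (rule even_card_Union_comps[of _ ?y])
      show "even (card D)" if "D \<in> {D \<in> comps ?y. D \<subseteq> C} - {T}" for D
        using even_disj[of D] dis[OF that] UT that by blast
    qed (use yS in auto)
    moreover have "even (card (C \<inter> ?y))"
    proof -
      have "C \<inter> ?y = C - {a, b}" using compsD(2)[OF C] by auto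
      moreover have "card (C - {a, b}) = card C - 2"
        using ab B_fin compsD(1)[OF C] by (subst card_Diff_subset) auto
      moreover have "even (card C)" using y C by (simp add: P_iff)
      ultimately show ?thesis by simp
    qed
    ultimately show ?thesis by simp
  qed (rule even_disj[OF T])
qed

lemma lowest2_exists:
  assumes x: "x \<in> P" and y: "y \<in> P" and xy: "x \<subseteq> y" and C: "C \<in> comps y" "\<not> C \<subseteq> x"
  obtains a b where "lowest2 C x a b"
proof -
  have fin: "finite C" using B_fin compsD(1)[OF C(1)] by blast
  have "even (card (C \<inter> x))" using even_card_comp_Int[OF C(1) xy P_sub[OF y] x] .
  moreover have "even (card C)" using y C(1) by (simp add: P_iff)
  moreover have "card (C - x) = card C - card (C \<inter> x)" using fin by (simp add: card_Diff_subset_Int)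
  moreover have "card (C - x) \<noteq> 0" using C(2) fin by auto
  ultimately have "even (card (C - x))" "card (C - x) \<noteq> 0" by auto
  then have c2: "2 \<le> card (C - x)" by (metis One_nat_def Suc_1 Suc_leI dvd_0_right le_neq_implies_less less_one linorder_not_less odd_one)
  define a where "a = Min (C - x)"
  have a: "a \<in> C - x" unfolding a_def by (rule Min_in) (use fin C(2) in auto)
  have ne: "C - x - {a} \<noteq> {}"
  proof
    assume "C - x - {a} = {}"
    then have "C - x = {a}" using a by blast
    then show False using c2 by simp
  qed
  define b where "b = Min (C - x - {a})"
  have b: "b \<in> C - x - {a}" unfolding b_def by (rule Min_in) (use fin ne in auto)
  have "a \<le> e" if "e \<in> C - x" for e unfolding a_def using that fin by auto
  moreover have "b \<le> e" if "e \<in> C - x - {a}" for e unfolding b_def using that fin by auto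
  ultimately have "lowest2 C x a b" unfolding lowest2_def using a b by (force simp: le_less)
  then show ?thesis by (rule that)
qed

text \<open>In \<open>key y z\<close> the difference \<open>y - z\<close> is meant to have two elements; by parity both lie in the
  component of \<open>y\<close> that contains the smaller one.\<close>

definition Q where "Q x y = {z \<in> P. x \<subseteq> z \<and> z \<subseteq> y \<and> card (y - z) = 2}"
definition key where "key y z = [Max (cm y (Min (y - z))), Min (y - z), Max (y - z)]"
definition first where "first z x y \<longleftrightarrow> z \<in> Q x y \<and> (\<forall>z'\<in>Q x y. key y z \<le> key y z')"
definition minc where "minc x y C \<longleftrightarrow>
  C \<in> comps y \<and> \<not> C \<subseteq> x \<and> (\<forall>D\<in>comps y. \<not> D \<subseteq> x \<longrightarrow> Max C \<le> Max D)"

lemma Q_cases: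
  assumes z: "z \<in> Q x y" and y: "y \<in> P"
  obtains a b where "a < b" "a \<in> y - x" "b \<in> y - x" "z = y - {a, b}" "y - z = {a, b}"
    "b \<in> cm y a" "key y z = [Max (cm y a), a, b]"
proof -
  have "\<exists>a b. a < b \<and> y - z = {a, b}"
  proof -
    obtain u v where uv: "y - z = {u, v}" "u \<noteq> v" using z by (auto simp: Q_def card_2_iff)
    then show ?thesis by (metis insert_commute nat_neq_iff)
  qed
  then obtain a b where ab: "a < b" "y - z = {a, b}" by blast
  have zz: "x \<subseteq> z" "z \<subseteq> y" "z \<in> P" using z by (auto simp: Q_def)
  have in_y: "a \<in> y" "b \<in> y" "a \<notin> z" "b \<notin> z" using ab(2) by auto
  have zeq: "z = y - {a, b}" using ab(2) zz(2) by blast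
  have a: "cm y a \<in> comps y" "a \<in> cm y a" using cm_comps[OF P_sub[OF y]] in_y by auto
  have "b \<in> cm y a"
  proof (rule ccontr)
    assume b: "b \<notin> cm y a"
    then have "cm y a \<inter> z = cm y a - {a}" unfolding zeq using compsD(2)[OF a(1)] by blast
    moreover have "even (card (cm y a \<inter> z))"
      by (rule even_card_comp_Int[OF a(1) zz(2) P_sub[OF y] zz(3)])
    moreover have "even (card (cm y a))" using y a(1) by (simp add: P_iff)
    moreover have "card (cm y a) = Suc (card (cm y a - {a}))"
      using a(2) B_fin[OF compsD(1)[OF a(1)]] by (metis card_Suc_Diff1)
    ultimately show False by simp
  qed
  moreover have "key y z = [Max (cm y a), a, b]"
    unfolding key_def ab(2) using ab(1) by (simp add: max_def min_def)
  moreover have "a \<in> y - x" "b \<in> y - x" using in_y zz(1) by auto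
  ultimately show ?thesis using ab zeq by (intro that[of a b])
qed

lemma key_inj:
  assumes "z \<in> Q x y" "z' \<in> Q x' y" "y \<in> P" "key y z = key y z'"
  shows "z = z'"
proof -
  obtain a b where "z = y - {a, b}" "key y z = [Max (cm y a), a, b]"
    using Q_cases[OF assms(1,3)] by metis
  moreover obtain a' b' where "z' = y - {a', b'}" "key y z' = [Max (cm y a'), a', b']"
    using Q_cases[OF assms(2,3)] by metis
  ultimately show ?thesis using assms(4) by simp
qed

lemma first_unique: "first z x y \<Longrightarrow> first z' x y \<Longrightarrow> y \<in> P \<Longrightarrow> z = z'"
  using key_inj[of z x y z' x] unfolding first_def by force

lemma comp_Max: "C \<in> comps y \<Longrightarrow> Max C \<in> C"
  using compsD(1)[of C y] B_fin B_ne by (intro Max_in) auto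

text \<open>The key compares component maxima before elements, so a least key uses the component of
  least maximum. Components are disjoint, so equal maxima mean equal components, and there the two
  smallest elements outside \<open>x\<close> win.\<close>

lemma first_lowest2:
  assumes x: "x \<in> P" and y: "y \<in> P" and xy: "x \<subseteq> y" and C: "minc x y C" and l2: "lowest2 C x a b"
  shows "first (y - {a, b}) x y"
proof -
  have Cc: "C \<in> comps y" "\<not> C \<subseteq> x" using C by (auto simp: minc_def)
  have ab: "a < b" "a \<in> C - x" "b \<in> C - x" using l2 by (auto simp: lowest2_def)
  have yab: "y - (y - {a, b}) = {a, b}" using ab compsD(2)[OF Cc(1)] by blast
  have Qz: "y - {a, b} \<in> Q x y"
    unfolding Q_def using remove_lowest2[OF x y xy Cc(1) l2] xy ab yab by auto
  have kz: "key y (y - {a, b}) = [Max C, a, b]"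
    unfolding key_def yab using ab cm_eq[OF Cc(1), of a] by (simp add: min_def max_def)
  have "key y (y - {a, b}) \<le> key y z'" if z': "z' \<in> Q x y" for z'
  proof -
    obtain a' b' where ab': "a' < b'" "a' \<in> y - x" "b' \<in> y - x" "b' \<in> cm y a'"
      "key y z' = [Max (cm y a'), a', b']"
      using Q_cases[OF z' y] by metis
    have D: "cm y a' \<in> comps y" "a' \<in> cm y a'" using cm_comps[OF P_sub[OF y]] ab' by auto
    then have le: "Max C \<le> Max (cm y a')" using C ab'(2) unfolding minc_def by blast
    show ?thesis
    proof (cases "Max C = Max (cm y a')")
      case True
      then have "cm y a' = C"
        using comps_eq[OF D(1) Cc(1)] comp_Max[OF D(1)] comp_Max[OF Cc(1)] by auto
      then have "a' = a \<or> a' = b \<or> b < a'" "b' = a \<or> b' = b \<or> b < b'"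
        using l2 ab' D unfolding lowest2_def by auto
      then have "a < a' \<or> (a = a' \<and> b \<le> b')" using ab(1) ab'(1) by linarith
      then show ?thesis unfolding kz ab'(5) using True by auto
    next
      case False
      then show ?thesis unfolding kz ab'(5) using le by simp
    qed
  qed
  then show ?thesis using Qz by (simp add: first_def)
qed

lemma first_exists:
  assumes x: "x \<in> P" and y: "y \<in> P" and xy: "x \<subset> y"
  obtains z C a b where "minc x y C" "lowest2 C x a b" "z = y - {a, b}" "first z x y"
proof -
  obtain e where e: "e \<in> y" "e \<notin> x" using xy by blast
  have "cm y e \<in> comps y" "e \<in> cm y e" using cm_comps[OF P_sub[OF y] e(1)] .
  then have "cm y e \<in> comps y \<and> \<not> cm y e \<subseteq> x" using e(2) by blast
  then obtain C where "(C \<in> comps y \<and> \<not> C \<subseteq> x) \<and> (\<forall>D. D \<in> comps y \<and> \<not> D \<subseteq> x \<longrightarrow> Max C \<le> Max D)"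
    using ex_has_least_nat[of "\<lambda>C. C \<in> comps y \<and> \<not> C \<subseteq> x" _ Max] by blast
  then have C: "minc x y C" by (auto simp: minc_def)
  then obtain a b where l2: "lowest2 C x a b"
    using lowest2_exists[OF x y, of C] xy by (auto simp: minc_def)
  show ?thesis using that[OF C l2 refl first_lowest2[OF x y _ C l2]] xy by blast
qed

lemma first_cases:
  assumes x: "x \<in> P" and y: "y \<in> P" and z: "first z x y"
  obtains C a b where "minc x y C" "lowest2 C x a b" "z = y - {a, b}"
proof -
  have "x \<subseteq> z" "z \<subseteq> y" "y \<noteq> z" using z by (auto simp: first_def Q_def)
  then have xy: "x \<subset> y" by blast
  obtain z' C a b where "minc x y C" "lowest2 C x a b" "z' = y - {a, b}" "first z' x y"
    by (rule first_exists[OF x y xy])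
  moreover from this have "z = z'" using first_unique[OF z _ y] by simp
  ultimately show ?thesis using that by simp
qed

text \<open>The local condition propagates upwards: a chain above \<open>x\<close> whose interior members are all first
  between their neighbours has its top step first above \<open>x\<close>. If the minimal component \<open>E\<close> of \<open>y\<close> differed from the component \<open>C\<close> of \<open>y\<close> that
  loses \<open>c\<close> and \<open>d\<close>, then the suffix of \<open>C\<close> above \<open>d\<close>, which is connected, would be contained in
  the minimal component of \<open>z\<close> and force its maximum to be that of \<open>C\<close>.\<close>
lemma first_propagates:
  assumes P: "x \<in> P" "w \<in> P" "z \<in> P" "y \<in> P" and xw: "x \<subseteq> w"
    and wz: "first w x z" and zy: "first z w y"
  shows "first z x y"
proof -
  obtain C' a b where C': "minc x z C'" "lowest2 C' x a b" "w = z - {a, b}"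
    using first_cases[OF P(1,3) wz] by metis
  obtain C c d where C: "minc w y C" "lowest2 C w c d" "z = y - {c, d}"
    using first_cases[OF P(2,4) zy] by metis
  have "x \<subseteq> z" and zy': "z \<subseteq> y" using xw C'(3) C(3) by auto
  then have xy: "x \<subseteq> y" by blast
  have Cc: "C \<in> comps y" and C'c: "C' \<in> comps z" using C(1) C'(1) by (auto simp: minc_def)
  have C'y: "C' \<subseteq> z" "C' \<in> B" and Cy: "C \<subseteq> y" "C \<in> B" using compsD[OF C'c] compsD[OF Cc] by auto
  have cd: "c < d" "c \<in> C" "d \<in> C" "c \<notin> w" "d \<notin> w" and ab: "a < b" "a \<in> C'" "b \<in> C'" "a \<notin> x" "b \<notin> x"
    using C(2) C'(2) by (auto simp: lowest2_def)
  have cdx: "c \<notin> x" "d \<notin> x" using cd xw by auto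
  have suffix: "Max C' = Max C \<and> d < a" if sub: "C' \<subseteq> C"
  proof -
    have "a \<in> C - w" using sub ab C'(3) by auto
    moreover have "a \<noteq> c" "a \<noteq> d" using C'y ab C(3) by auto
    ultimately have da: "d < a" using C(2) by (auto simp: lowest2_def)
    have U: "{e \<in> C. d < e} \<in> B" by (rule suffix_B) (use Cy cd da sub ab in auto)
    have "{e \<in> C. d < e} \<subseteq> z" using Cy cd C(3) by auto
    then have "{e \<in> C. d < e} \<subseteq> C'" using comps_absorb[OF C'c U] da sub ab by blast
    moreover have "Max C \<in> {e \<in> C. d < e}"
      using comp_Max[OF Cc] Max_ge[OF B_fin[OF Cy(2)], of a] da sub ab by auto
    ultimately have "Max C \<in> C'" by blast
    then have "Max C \<le> Max C'" using B_fin[OF C'y(2)] by simp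
    moreover have "Max C' \<le> Max C" using sub comp_Max[OF C'c] B_fin[OF Cy(2)] by auto
    ultimately show ?thesis using da by simp
  qed
  have "x \<subset> y" using xy cd(2) cdx(1) Cy(1) by blast
  then obtain E where E: "minc x y E" by (rule first_exists[OF P(1,4)])
  then have Ec: "E \<in> comps y" "\<not> E \<subseteq> x" by (auto simp: minc_def)
  \<comment> \<open>If the component \<open>D\<close> of \<open>y\<close> around \<open>a\<close>
    were not \<open>C\<close>, it would pass to \<open>z\<close> unchanged and so equal
    \<open>C'\<close>. Being a candidate for the minimal component of \<open>y\<close>, it could not
    have a maximum below that of \<open>E\<close>, and equal maxima would give
    \<open>D = E\<close>.\<close>
  have C'_in: "C' \<subseteq> C" if "Max C' < Max E \<or> Max C' \<le> Max C \<and> E = C"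
  proof -
    define D where "D = cm y a"
    have D: "D \<in> comps y" "a \<in> D" unfolding D_def using cm_comps[OF P_sub[OF P(4)], of a] C'y ab zy' by auto
    have C'D: "C' \<subseteq> D" using comps_mono[OF C'c zy' D(1)] D(2) ab by blast
    have "D = C"
    proof (rule ccontr)
      assume DC: "D \<noteq> C"
      then have "D \<inter> C = {}" using comps_eq[OF D(1) Cc] by blast
      then have "D \<subseteq> z" using compsD(2)[OF D(1)] cd C(3) by blast
      then have "C' = D" using C'D C'c compsD(1)[OF D(1)] by (auto simp: comps_iff)
      moreover have "Max E \<le> Max D" using E D ab by (auto simp: minc_def)
      ultimately have "Max C' = Max E" using that by auto
      then have "C' = E" using comps_eq[OF D(1) Ec(1)] comp_Max[OF D(1)] comp_Max[OF Ec(1)] \<open>C' = D\<close> by auto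
      then show False using that DC \<open>C' = D\<close> by auto
    qed
    then show ?thesis using C'D by simp
  qed
  have EC: "E = C"
  proof (rule ccontr)
    assume EC: "E \<noteq> C"
    then have dis: "E \<inter> C = {}" using comps_eq[OF Ec(1) Cc] by blast
    then have "E \<subseteq> z" using compsD(2)[OF Ec(1)] cd C(3) by blast
    then have Ecz: "E \<in> comps z" using comps_shrink[OF Ec(1) zy'] by blast
    have "Max C' \<le> Max E" using C'(1) Ecz Ec(2) by (auto simp: minc_def)
    moreover have "Max E \<le> Max C" using E Cc cd cdx by (auto simp: minc_def)
    moreover have "Max E \<noteq> Max C" using dis comp_Max[OF Ec(1)] comp_Max[OF Cc] by auto
    ultimately consider "Max C' < Max E" "Max E < Max C" | "Max C' = Max E" "Max E < Max C" by linarith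
    then show False
    proof cases
      case 1
      then have "Max C' = Max C" using suffix C'_in by blast
      then show False using 1 by simp
    next
      case 2
      then have "C' = E" using comps_eq[OF C'c Ecz] comp_Max[OF C'c] comp_Max[OF Ecz] by auto
      then have "\<not> E \<subseteq> w" using ab C'(3) by auto
      then have "Max C \<le> Max E" using C(1) Ec(1) by (auto simp: minc_def)
      then show False using 2 by simp
    qed
  qed
  have "lowest2 C x c d"
    unfolding lowest2_def
  proof (intro conjI ballI)
    \<comment> \<open>A counterexample \<open>e\<close> lies below \<open>d\<close> and survives in
      \<open>z\<close>. Its component there lies in \<open>C\<close> and, by the minimality of
      \<open>C'\<close> and the preserved maximum, is \<open>C'\<close>; so \<open>e\<close> is
      \<open>a\<close>, \<open>b\<close> or larger, all of them above \<open>d\<close>.\<close>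
    fix e assume e: "e \<in> C - x"
    show "e = c \<or> e = d \<or> d < e"
    proof (rule ccontr)
      assume "\<not> (e = c \<or> e = d \<or> d < e)"
      then have ecd: "e \<noteq> c" "e \<noteq> d" "e < d" by auto
      then have ez: "e \<in> z" using e Cy C(3) by auto
      define G where "G = cm z e"
      have G: "G \<in> comps z" "e \<in> G" unfolding G_def using cm_comps[OF P_sub[OF P(3)] ez] .
      have GC: "G \<subseteq> C" using comps_mono[OF G(1) zy' Cc] G(2) e by blast
      have le1: "Max C' \<le> Max G" using C'(1) G e by (auto simp: minc_def)
      have le2: "Max G \<le> Max C" using GC comp_Max[OF G(1)] B_fin[OF Cy(2)] by auto
      have "C' \<subseteq> C" using C'_in le1 le2 EC by auto
      then have s: "Max C' = Max C" "d < a" using suffix by auto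
      then have "G = C'" using comps_eq[OF G(1) C'c] comp_Max[OF G(1)] comp_Max[OF C'c] le1 le2 by auto
      then have "e = a \<or> e = b \<or> b < e" using C'(2) G(2) e by (auto simp: lowest2_def)
      then show False using ecd s ab by linarith
    qed
  qed (use cd cdx in auto)
  then show ?thesis using first_lowest2[OF P(1,4) xy] E EC C(3) by blast
qed

end

subsection \<open>Lexicographic shelling of the order complex\<close>

text \<open>The facets of the intersection complex are the ridges \<open>fs ! j - {v}\<close>
  contained in an earlier facet: every common face lies in such a ridge, and \<open>fs ! j\<close>
  itself is not a common face, since distinct facets of equal size do not contain each
  other.\<close>

lemma shelling_criterion:
  assumes card: "\<And>F. F \<in> set fs \<Longrightarrow> finite F \<and> card F = m" and dist: "distinct fs"
    and j: "0 < j" "j < length fs"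
    and ex: "\<And>i. i < j \<Longrightarrow> \<exists>l<j. \<exists>v\<in>fs ! j. fs ! i \<inter> fs ! j \<subseteq> fs ! j - {v} \<and> fs ! j - {v} \<subseteq> fs ! l"
  shows "pure_card {G. G \<subseteq> fs ! j \<and> (\<exists>i<j. G \<subseteq> fs ! i)} (m - 1)"
proof -
  define C where "C = {G. G \<subseteq> fs ! j \<and> (\<exists>i<j. G \<subseteq> fs ! i)}"
  have C: "G \<in> C \<longleftrightarrow> G \<subseteq> fs ! j \<and> (\<exists>i<j. G \<subseteq> fs ! i)" for G by (simp add: C_def)
  have Fj: "finite (fs ! j)" "card (fs ! j) = m" using card j by auto
  have ridge: "\<exists>v\<in>fs ! j. G \<subseteq> fs ! j - {v} \<and> fs ! j - {v} \<in> C" if G: "G \<in> C" for G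
  proof -
    obtain i where i: "i < j" "G \<subseteq> fs ! i" using G C by blast
    obtain l v where lv: "l < j" "v \<in> fs ! j" "fs ! i \<inter> fs ! j \<subseteq> fs ! j - {v}" "fs ! j - {v} \<subseteq> fs ! l"
      using ex[OF i(1)] by blast
    moreover have "G \<subseteq> fs ! j" using G C by blast
    ultimately show ?thesis using i(2) unfolding C by blast
  qed
  have not_top: "fs ! j \<notin> C"
  proof
    assume "fs ! j \<in> C"
    then obtain i where i: "i < j" "fs ! j \<subseteq> fs ! i" using C by blast
    have "fs ! i \<in> set fs" using i(1) j(2) by simp
    then have "fs ! j = fs ! i" using card_subset_eq[OF _ i(2)] card Fj(2) by simp
    then show False using dist i(1) j(2) by (simp add: nth_eq_iff_index_eq)
  qed
  have facet: "fs ! j - {v} \<in> facets C" if v: "v \<in> fs ! j" "fs ! j - {v} \<in> C" for v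
  proof -
    have "H = fs ! j - {v}" if H: "H \<in> C" "fs ! j - {v} \<subseteq> H" for H
    proof -
      have "H \<noteq> fs ! j" using H(1) not_top by metis
      moreover have "H \<subseteq> fs ! j" using H(1) C by blast
      ultimately show ?thesis using H(2) v(1) by blast
    qed
    then show ?thesis using v(2) unfolding facets_def by blast
  qed
  show ?thesis
    unfolding pure_card_def C_def[symmetric]
  proof (intro conjI ballI)
    fix G assume G: "G \<in> facets C"
    then have "G \<in> C" by (simp add: facets_def)
    then obtain v where v: "v \<in> fs ! j" "G \<subseteq> fs ! j - {v}" "fs ! j - {v} \<in> C" using ridge by blast
    then have "G = fs ! j - {v}" using G v(2,3) unfolding facets_def by blast
    then show "card G = m - 1" using v(1) Fj by simp
  next
    fix G assume "G \<in> C"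
    then obtain v where v: "v \<in> fs ! j" "G \<subseteq> fs ! j - {v}" "fs ! j - {v} \<in> C" using ridge by blast
    then show "\<exists>F\<in>facets C. G \<subseteq> F" using facet by blast
  qed
qed

lemma list_less_iff_first_difference:
  fixes xs ys :: "'a::linorder list"
  assumes "length xs = length ys"
  shows "xs < ys \<longleftrightarrow> (\<exists>p<length ys. (\<forall>i<p. xs ! i = ys ! i) \<and> xs ! p < ys ! p)"
  using assms
proof (induction xs ys rule: list_induct2)
  case (Cons x xs y ys)
  show ?case
  proof
    assume "x # xs < y # ys"
    then consider "x < y" | "x = y" "xs < ys" by auto
    then show "\<exists>p<length (y # ys). (\<forall>i<p. (x # xs) ! i = (y # ys) ! i) \<and> (x # xs) ! p < (y # ys) ! p"
    proof cases
      case 1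
      then show ?thesis by (intro exI[of _ 0]) auto
    next
      case 2
      then obtain p where "p < length ys" "\<forall>i<p. xs ! i = ys ! i" "xs ! p < ys ! p" using Cons.IH by blast
      then show ?thesis using 2(1) by (intro exI[of _ "Suc p"]) (auto simp: nth_Cons split: nat.split)
    qed
  next
    assume "\<exists>p<length (y # ys). (\<forall>i<p. (x # xs) ! i = (y # ys) ! i) \<and> (x # xs) ! p < (y # ys) ! p"
    then obtain p where p: "p < length (y # ys)" "\<And>i. i < p \<Longrightarrow> (x # xs) ! i = (y # ys) ! i" "(x # xs) ! p < (y # ys) ! p"
      by blast
    show "x # xs < y # ys"
    proof (cases p)
      case 0
      then show ?thesis using p(3) by simp
    next
      case (Suc q)
      then have "x = y" using p(2)[of 0] by simp
      moreover have "q < length ys" "xs ! q < ys ! q" using p(1,3) Suc by auto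
      moreover have "xs ! i = ys ! i" if "i < q" for i using p(2)[of "Suc i"] Suc that by simp
      ultimately have "xs < ys" "x = y" using Cons.IH by blast+
      then show ?thesis by simp
    qed
  qed
qed simp

section \<open>Maximal chains, their words of labels, and single exchanges\<close>

locale even_chordal_building_set = chordal_building_set +
  fixes k :: nat
  assumes S_P: "S \<in> P" and card_S: "card S = 2 * k" and k: "2 \<le> k"
begin

text \<open>A maximal chain as a function of rank, with the ends \<open>{}\<close> and
  \<open>S\<close> added so that every member of the proper part has two neighbours. Values beyond
  \<open>k\<close> are unconstrained, so flags are compared only up to \<open>k\<close>.\<close>

definition flag where "flag c \<longleftrightarrow> c 0 = {} \<and> c k = S \<and> (\<forall>i\<le>k. c i \<in> P) \<and>
  (\<forall>i<k. c i \<subseteq> c (Suc i) \<and> card (c (Suc i) - c i) = 2)"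

abbreviation OC where "OC \<equiv> order_complex (P_proper S B)"

lemma P_proper_eq: "P_proper S B = P - {{}, S}"
  by (simp add: P_proper_def P_def)

lemma flagD:
  assumes "flag c"
  shows "c 0 = {}" "c k = S" "i \<le> k \<Longrightarrow> c i \<in> P" "i < k \<Longrightarrow> c i \<subseteq> c (Suc i)"
    "i < k \<Longrightarrow> card (c (Suc i) - c i) = 2"
  using assms by (auto simp: flag_def)

lemma flag_mono:
  assumes c: "flag c" and "i \<le> j" "j \<le> k"
  shows "c i \<subseteq> c j"
  using assms(2,3)
proof (induction j rule: dec_induct)
  case (step j)
  then show ?case using flagD(4)[OF c, of j] by auto
qed simp

lemma flag_card:
  assumes c: "flag c" and "i \<le> k"
  shows "card (c i) = 2 * i"
  using assms(2)
proof (induction i)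
  case (Suc i)
  have fin: "finite (c (Suc i))" using P_fin flagD(3)[OF c] Suc.prems by blast
  have sub: "c i \<subseteq> c (Suc i)" using flagD(4)[OF c, of i] Suc.prems by simp
  note card_Diff_subset[OF finite_subset[OF sub fin] sub] card_mono[OF fin sub]
  then show ?case using Suc flagD(5)[OF c, of i] by simp
qed (simp add: flagD(1)[OF c])

text \<open>Rank is half the cardinality, so a set occurring in two flags occurs at the same index
  in both.\<close>

lemma flag_inj: "flag c \<Longrightarrow> flag c' \<Longrightarrow> i \<le> k \<Longrightarrow> j \<le> k \<Longrightarrow> c i = c' j \<Longrightarrow> i = j"
  using flag_card[of c i] flag_card[of c' j] by simp

lemma flag_Q: "flag c \<Longrightarrow> s \<le> i \<Longrightarrow> i < k \<Longrightarrow> c i \<in> Q (c s) (c (Suc i))"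
  using flag_mono[of c s i] flagD(3,4,5)[of c i] by (auto simp: Q_def)

lemma flag_eq:
  assumes "flag c" "flag c'" "c ` {1..<k} = c' ` {1..<k}" "i \<le> k"
  shows "c i = c' i"
proof (cases "i = 0 \<or> i = k")
  case True
  then show ?thesis using flagD(1,2)[OF assms(1)] flagD(1,2)[OF assms(2)] by auto
next
  case False
  then have "c i \<in> c ` {1..<k}" using assms(4) by auto
  then have "c i \<in> c' ` {1..<k}" by (simp only: assms(3))
  then obtain j where "j \<in> {1..<k}" "c i = c' j" by blast
  then show ?thesis using flag_inj[OF assms(1,2,4), of j] by auto
qed

lemma flag_image:
  assumes c: "flag c"
  shows "c ` {1..<k} \<in> facets OC" "card (c ` {1..<k}) = k - 1"
proof -
  have ne: "c i \<noteq> {} \<and> c i \<noteq> S" if "i \<in> {1..<k}" for i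
    using that flag_inj[OF c c, of i 0] flag_inj[OF c c, of i k] flagD(1,2)[OF c] by auto
  have "c ` {1..<k} \<subseteq> P_proper S B"
    unfolding P_proper_eq
  proof (rule image_subsetI)
    fix i assume i: "i \<in> {1..<k}"
    then show "c i \<in> P - {{}, S}" using ne[OF i] flagD(3)[OF c, of i] by simp
  qed
  moreover have "\<forall>x\<in>c ` {1..<k}. \<forall>y\<in>c ` {1..<k}. x \<subseteq> y \<or> y \<subseteq> x"
  proof (intro ballI)
    fix x y assume "x \<in> c ` {1..<k}" "y \<in> c ` {1..<k}"
    then obtain i j where "i < k" "j < k" "x = c i" "y = c j" by auto
    then show "x \<subseteq> y \<or> y \<subseteq> x" using flag_mono[OF c, of i j] flag_mono[OF c, of j i] by (cases "i \<le> j") auto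
  qed
  ultimately have oc: "c ` {1..<k} \<in> OC" using k by (auto simp: order_complex_def)
  have "H = c ` {1..<k}" if H: "H \<in> OC" "c ` {1..<k} \<subseteq> H" for H
  proof -
    have "h \<in> c ` {1..<k}" if h: "h \<in> H" for h
    proof -
      have hP: "h \<in> P" "h \<noteq> {}" "h \<noteq> S" using H(1) h by (auto simp: order_complex_def P_proper_eq)
      obtain j where j: "card h = 2 * j" using P_even[OF hP(1)] by (auto elim: evenE)
      have "card h \<noteq> 0" using P_fin[OF hP(1)] hP(2) by simp
      moreover have "card h < card S" using psubset_card_mono[OF fin_S, of h] P_sub[OF hP(1)] hP(3) by blast
      ultimately have jk: "j \<in> {1..<k}" using j card_S by auto
      then have "c j \<in> H" using H(2) by auto
      then have comp: "h \<subseteq> c j \<or> c j \<subseteq> h" using H(1) h by (auto simp: order_complex_def)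
      have "card (c j) = card h" "finite (c j)" using flag_card[OF c, of j] j jk P_fin flagD(3)[OF c, of j] by auto
      then have "h = c j" using comp card_subset_eq[of "c j" h] card_subset_eq[OF P_fin[OF hP(1)], of "c j"] by auto
      then show ?thesis using jk by blast
    qed
    then show ?thesis using H(2) by blast
  qed
  then show "c ` {1..<k} \<in> facets OC" using oc unfolding facets_def by blast
  have "inj_on c {1..<k}" using flag_inj[OF c c] by (intro inj_onI) auto
  then show "card (c ` {1..<k}) = k - 1" by (simp add: card_image)
qed

text \<open>Let \<open>x\<close> be the largest member of the chain strictly below \<open>y\<close>,
  or \<open>{}\<close> if there is none. A step from \<open>y\<close> that stays above
  \<open>x\<close> keeps comparability with the whole chain.\<close>

lemma chain_step:
  assumes G: "G \<in> OC" and y: "y \<in> P" "y \<noteq> {}" "\<forall>g\<in>G. g \<subseteq> y \<or> y \<subseteq> g"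
  shows "\<exists>z. z \<in> P \<and> z \<subseteq> y \<and> card (y - z) = 2 \<and> (\<forall>g\<in>G. g \<subseteq> z \<or> z \<subseteq> g)"
proof -
  define x where "x = \<Union>{g \<in> G. g \<subset> y}"
  have fin: "finite {g \<in> G. g \<subset> y}" using G by (auto simp: order_complex_def)
  have chain: "\<forall>g\<in>G. \<forall>h\<in>G. g \<subseteq> h \<or> h \<subseteq> g" and GP: "G \<subseteq> P"
    using G by (auto simp: order_complex_def P_proper_eq)
  have x: "x \<in> P \<and> x \<subset> y"
  proof (cases "{g \<in> G. g \<subset> y} = {}")
    case True
    then have "x = {}" unfolding x_def by (simp only: Union_empty)
    then show ?thesis using empty_P y(2) by auto
  next
    case False
    have "\<Union>{g \<in> G. g \<subset> y} \<in> {g \<in> G. g \<subset> y}"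
      by (rule Union_in_chain[OF fin False]) (use chain in \<open>auto simp: subset_chain_def\<close>)
    then show ?thesis using GP unfolding x_def by blast
  qed
  obtain z where "first z x y" using first_exists[of x y] x y(1) by metis
  then have z: "z \<in> P" "x \<subseteq> z" "z \<subseteq> y" "card (y - z) = 2" by (auto simp: first_def Q_def)
  moreover have "g \<subseteq> z \<or> z \<subseteq> g" if "g \<in> G" for g
  proof (cases "y \<subseteq> g")
    case False
    then have "g \<subset> y" using y(3) that by blast
    then have "g \<subseteq> x" using that by (auto simp: x_def)
    then show ?thesis using z by blast
  qed (use z in blast)
  ultimately show ?thesis by blast
qed

lemma extend_to_flag:
  assumes G: "G \<in> OC"
  obtains c where "flag c" "G \<subseteq> c ` {1..<k}"
proof -
  define good where "good y \<longleftrightarrow> y \<in> P \<and> (\<forall>g\<in>G. g \<subseteq> y \<or> y \<subseteq> g)" for y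
  have GP: "g \<in> P \<and> g \<noteq> {} \<and> g \<noteq> S" if "g \<in> G" for g
    using G that by (auto simp: order_complex_def P_proper_eq)
  have "\<forall>y. \<exists>z. good y \<and> y \<noteq> {} \<longrightarrow> good z \<and> z \<subseteq> y \<and> card (y - z) = 2"
    using chain_step[OF G] unfolding good_def by meson
  then obtain nxt where nxt: "\<And>y. good y \<Longrightarrow> y \<noteq> {} \<Longrightarrow> good (nxt y) \<and> nxt y \<subseteq> y \<and> card (y - nxt y) = 2"
    by metis
  define d where "d i = (nxt ^^ i) S" for i
  have d_Suc: "d (Suc i) = nxt (d i)" for i by (simp add: d_def)
  have d: "good (d i) \<and> card (d i) = 2 * (k - i)" if "i \<le> k" for i
    using that
  proof (induction i)
    case 0
    have "good S" using S_P GP P_sub by (auto simp: good_def)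
    then show ?case by (simp add: d_def card_S)
  next
    case (Suc i)
    then have di: "good (d i)" "card (d i) = 2 * (k - i)" by auto
    then have "d i \<noteq> {}" using Suc.prems by auto
    note n = nxt[OF di(1) this]
    have "finite (d i)" using di(1) P_fin by (auto simp: good_def)
    then have "card (d i - nxt (d i)) = card (d i) - card (nxt (d i))"
      using n by (intro card_Diff_subset) (auto intro: finite_subset)
    moreover have "card (nxt (d i)) \<le> card (d i)" using n \<open>finite (d i)\<close> by (intro card_mono) auto
    ultimately show ?case using n di(2) by (auto simp: d_Suc)
  qed
  have step: "d (Suc i) \<subseteq> d i \<and> card (d i - d (Suc i)) = 2" if "i < k" for i
  proof -
    have "d i \<noteq> {}" using d[of i] that by auto
    then show ?thesis using nxt d[of i] that by (simp add: d_Suc)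
  qed
  define c where "c i = d (k - i)" for i
  have flag: "flag c"
    unfolding flag_def
  proof (intro conjI allI impI)
    have "finite (d k)" "card (d k) = 0" using d[of k] P_fin by (auto simp: good_def)
    then show "c 0 = {}" by (simp add: c_def)
    show "c k = S" by (simp add: c_def d_def)
    show "c i \<in> P" for i using d[of "k - i"] by (simp add: c_def good_def)
    show "c i \<subseteq> c (Suc i)" "card (c (Suc i) - c i) = 2" if "i < k" for i
      using step[of "k - Suc i"] that by (auto simp: c_def Suc_diff_Suc)
  qed
  have "g \<in> c ` {1..<k}" if g: "g \<in> G" for g
  proof -
    have gP: "g \<in> P" "g \<noteq> {}" "g \<noteq> S" using GP[OF g] by auto
    obtain j where j: "card g = 2 * j" using P_even[OF gP(1)] by (auto elim: evenE)
    have "card g \<noteq> 0" using P_fin[OF gP(1)] gP(2) by simp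
    moreover have "card g < card S" using psubset_card_mono[OF fin_S, of g] P_sub[OF gP(1)] gP(3) by blast
    ultimately have jk: "j \<in> {1..<k}" using j card_S by auto
    have comp: "g \<subseteq> c j \<or> c j \<subseteq> g" using d[of "k - j"] g by (auto simp: good_def c_def)
    have "card (c j) = card g" "finite (c j)" using flag_card[OF flag, of j] j jk P_fin flagD(3)[OF flag, of j] by auto
    then have "g = c j" using comp card_subset_eq[of "c j" g] card_subset_eq[OF P_fin[OF gP(1)], of "c j"] by auto
    then show ?thesis using jk by blast
  qed
  then show ?thesis using that[OF flag] by blast
qed

lemma facet_flag:
  assumes "F \<in> facets OC"
  obtains c where "flag c" "F = c ` {1..<k}"
proof -
  have F: "F \<in> OC" using assms by (simp add: facets_def)
  then obtain c where c: "flag c" "F \<subseteq> c ` {1..<k}" by (rule extend_to_flag)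
  then have "F = c ` {1..<k}" using flag_image(1)[OF c(1)] assms by (auto simp: facets_def)
  then show ?thesis using that c(1) by blast
qed

lemma pure_OC: "pure_card OC (k - 1)"
  unfolding pure_card_def
  using facet_flag flag_image extend_to_flag by metis

text \<open>Labels are read from the top down: entry \<open>i\<close> belongs to the step from rank
  \<open>k - i\<close> to rank \<open>k - i - 1\<close>. The words are lists of lists, compared
  lexicographically at both levels.\<close>

definition keys where "keys c = map (\<lambda>i. key (c (k - i)) (c (k - Suc i))) [0..<k]"

lemma keys_nth: "i < k \<Longrightarrow> keys c ! i = key (c (k - i)) (c (k - Suc i))" and length_keys: "length (keys c) = k"
  by (simp_all add: keys_def)

text \<open>Starting from \<open>S\<close>, each label determines the next lower member, so
  agreement of the first \<open>p\<close> labels fixes the top \<open>p + 1\<close> members.\<close>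

lemma keys_agree:
  assumes c: "flag c" "flag c'" and eq: "\<And>i. i < p \<Longrightarrow> keys c ! i = keys c' ! i" and "i \<le> p" "p \<le> k"
  shows "c (k - i) = c' (k - i)"
  using \<open>i \<le> p\<close>
proof (induction i)
  case 0
  then show ?case using flagD(2)[OF c(1)] flagD(2)[OF c(2)] by simp
next
  case (Suc i)
  then have i: "i < k" "c (k - i) = c' (k - i)" using \<open>p \<le> k\<close> by auto
  have s: "k - i = Suc (k - Suc i)" using i by simp
  have "key (c (k - i)) (c (k - Suc i)) = key (c (k - i)) (c' (k - Suc i))"
    using eq[of i] Suc.prems i by (simp add: keys_nth)
  moreover have "c (k - Suc i) \<in> Q {} (c (k - i))" "c' (k - Suc i) \<in> Q {} (c (k - i))"
    using flag_Q[OF c(1), of 0 "k - Suc i"] flag_Q[OF c(2), of 0 "k - Suc i"] 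
      flagD(1)[OF c(1)] flagD(1)[OF c(2)] i
    by (simp_all flip: s)
  ultimately show ?case
    using key_inj[of "c (k - Suc i)" "{}" "c (k - i)" "c' (k - Suc i)" "{}"] flagD(3)[OF c(1), of "k - i"] by simp
qed

lemma keys_inj: "flag c \<Longrightarrow> flag c' \<Longrightarrow> keys c = keys c' \<Longrightarrow> i \<le> k \<Longrightarrow> c i = c' i"
  using keys_agree[of c c' k "k - i"] by simp

text \<open>Below rank \<open>t + 1\<close> the flags separate for the first time, and they meet
  again at rank \<open>s\<close>. If every member of \<open>c\<close> strictly between these ranks
  were first between its neighbours, propagation would make \<open>c t\<close> first above
  \<open>c s\<close>, against the smaller label of \<open>c'\<close>. Some member is therefore not
  first, and replacing it by the first one lowers the word.\<close>

lemma flag_exchange: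
  assumes c: "flag c" and c': "flag c'" and less: "keys c' < keys c"
  obtains l c'' where "0 < l" "l < k" "flag c''" "keys c'' < keys c"
    "\<forall>i. i \<noteq> l \<longrightarrow> c'' i = c i" "c l \<notin> c' ` {1..<k}"
proof -
  obtain p where p: "p < k" "\<And>i. i < p \<Longrightarrow> keys c' ! i = keys c ! i" "keys c' ! p < keys c ! p"
    using less unfolding list_less_iff_first_difference[OF trans[OF length_keys length_keys[symmetric]]] length_keys
    by blast
  define t where "t = k - Suc p"
  have t: "t < k" "k - p = Suc t" using p(1) by (auto simp: t_def)
  have ct: "c' (Suc t) = c (Suc t)" using keys_agree[OF c' c p(2), where i = p] p(1) t by simp
  have key_less: "key (c (Suc t)) (c' t) < key (c (Suc t)) (c t)"
    using p(1,3) t ct by (simp add: keys_nth t_def[symmetric])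
  \<comment> \<open>Both flags have \<open>{}\<close> at rank 0, so a common rank exists. Maximality
    makes them differ at all ranks from \<open>s + 1\<close> to \<open>t\<close>, so the exchanged
    member does not lie on \<open>c'\<close>.\<close>
  define s where "s = Max {s. s \<le> t \<and> c s = c' s}"
  have fin: "finite {s. s \<le> t \<and> c s = c' s}" by simp
  have "s \<in> {s. s \<le> t \<and> c s = c' s}"
    unfolding s_def by (rule Max_in[OF fin]) (use flagD(1) c c' in auto)
  then have s: "s \<le> t" "c s = c' s" by auto
  have "s \<noteq> t" using s(2) key_less by auto
  then have st: "s < t" using s(1) by simp
  have differ: "c i \<noteq> c' i" if "s < i" "i \<le> t" for i
    using that Max_ge[OF fin, of i] unfolding s_def[symmetric] by auto
  have "\<exists>l. s < l \<and> l \<le> t \<and> \<not> first (c l) (c (l - 1)) (c (Suc l))"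
  proof (rule ccontr)
    assume "\<not> ?thesis"
    then have loc: "first (c l) (c (l - 1)) (c (Suc l))" if "s < l" "l \<le> t" for l using that by blast
    have "j \<le> t \<Longrightarrow> first (c j) (c s) (c (Suc j))" if "Suc s \<le> j" for j
      using that
    proof (induction j rule: dec_induct)
      case base
      then show ?case using loc[of "Suc s"] by simp
    next
      case (step j)
      show ?case
      proof (rule first_propagates[of _ "c j"])
        show "c s \<in> P" "c j \<in> P" "c (Suc j) \<in> P" "c (Suc (Suc j)) \<in> P"
          using flagD(3)[OF c] step t st by auto
        show "c s \<subseteq> c j" using flag_mono[OF c] step t by auto
        show "first (c j) (c s) (c (Suc j))" using step by simp
        show "first (c (Suc j)) (c j) (c (Suc (Suc j)))" using loc[of "Suc j"] step by simp
      qed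
    qed
    then have "first (c t) (c s) (c (Suc t))" using st by simp
    moreover have "c' t \<in> Q (c s) (c (Suc t))" using flag_Q[OF c' s(1) t(1)] ct s(2) by simp
    ultimately show False using key_less by (auto simp: first_def)
  qed
  then obtain l where l: "s < l" "l \<le> t" "\<not> first (c l) (c (l - 1)) (c (Suc l))" by blast
  have lk: "0 < l" "l < k" using l t by auto
  have clP: "c (l - 1) \<in> P" "c (Suc l) \<in> P" using flagD(3)[OF c] lk by auto
  have sub: "c (l - 1) \<subseteq> c (Suc l)" using flag_mono[OF c] lk by auto
  have "c (l - 1) \<noteq> c (Suc l)"
  proof
    assume "c (l - 1) = c (Suc l)"
    then have "l - 1 = Suc l" using flag_inj[OF c c] lk by auto
    then show False using lk by linarith
  qed
  then obtain z where z: "first z (c (l - 1)) (c (Suc l))" using first_exists[OF clP] sub by blast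
  then have zQ: "z \<in> P" "c (l - 1) \<subseteq> z" "z \<subseteq> c (Suc l)" "card (c (Suc l) - z) = 2"
    by (auto simp: first_def Q_def)
  have clQ: "c l \<in> Q (c (l - 1)) (c (Suc l))" using flag_Q[OF c, of "l - 1" l] lk by simp
  have "z \<noteq> c l" using z l(3) by auto
  then have "key (c (Suc l)) z \<noteq> key (c (Suc l)) (c l)"
    using key_inj[OF _ clQ clP(2)] z by (auto simp: first_def)
  then have kz: "key (c (Suc l)) z < key (c (Suc l)) (c l)"
    using z clQ by (auto simp: first_def)
  define c'' where "c'' = c(l := z)"
  have c'': "c'' l = z" "\<And>i. i \<noteq> l \<Longrightarrow> c'' i = c i" by (auto simp: c''_def)
  have fin: "finite (c (Suc l))" "finite z" "finite (c (l - 1))" using P_fin clP zQ(1) by auto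
  have "card (c (Suc l) - z) = card (c (Suc l)) - card z" "card (z - c (l - 1)) = card z - card (c (l - 1))"
    "card z \<le> card (c (Suc l))"
    using card_Diff_subset[OF fin(2) zQ(3)] card_Diff_subset[OF fin(3) zQ(2)] card_mono[OF fin(1) zQ(3)] by auto
  then have cz: "card (z - c (l - 1)) = 2"
    using zQ(4) flag_card[OF c, of "Suc l"] flag_card[OF c, of "l - 1"] lk by auto
  have "flag c''"
    unfolding flag_def
  proof (intro conjI allI impI)
    show "c'' 0 = {}" "c'' k = S" using c'' lk flagD(1,2)[OF c] by auto
    show "c'' i \<in> P" if "i \<le> k" for i using c'' zQ(1) flagD(3)[OF c that] by (cases "i = l") auto
    fix i assume i: "i < k"
    consider "i = l" | "Suc i = l" | "i \<noteq> l" "Suc i \<noteq> l" by blast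
    then have "c'' i \<subseteq> c'' (Suc i) \<and> card (c'' (Suc i) - c'' i) = 2"
    proof cases
      case 1
      then show ?thesis using c'' zQ by simp
    next
      case 2
      then have "l - 1 = i" by simp
      then show ?thesis using 2 c''(1) c''(2)[of i] zQ(2) cz by simp
    next
      case 3
      then show ?thesis using c''(2) flagD(4,5)[OF c i] by simp
    qed
    then show "c'' i \<subseteq> c'' (Suc i)" "card (c'' (Suc i) - c'' i) = 2" by auto
  qed
  moreover have "keys c'' < keys c"
    unfolding list_less_iff_first_difference[OF trans[OF length_keys length_keys[symmetric]]] length_keys
  proof (intro exI conjI allI impI)
    \<comment> \<open>The exchange also affects the entry for the step below \<open>l\<close>, but
      the entry for the step from \<open>l + 1\<close> to \<open>l\<close> comes earlier and
      decides.\<close>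
    show "k - Suc l < k" using lk by simp
    show "keys c'' ! i = keys c ! i" if "i < k - Suc l" for i
    proof -
      have "k - i \<noteq> l" "k - Suc i \<noteq> l" "i < k" using that by auto
      then show ?thesis by (simp add: keys_nth c''(2))
    qed
    have "k - (k - Suc l) = Suc l" "k - Suc (k - Suc l) = l" "k - Suc l < k" using lk by auto
    then show "keys c'' ! (k - Suc l) < keys c ! (k - Suc l)"
      using kz c''(1) c''(2)[of "Suc l"] by (simp only: keys_nth)
  qed
  moreover have "c l \<notin> c' ` {1..<k}"
  proof
    assume "c l \<in> c' ` {1..<k}"
    then obtain j where j: "j < k" "c l = c' j" by auto
    then have "l = j" using flag_inj[OF c c', of l j] lk by simp
    then show False using differ[OF l(1,2)] j(2) by simp
  qed
  ultimately show ?thesis using that[OF lk] c''(2) by blast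
qed

section \<open>The shelling order and the remaining conditions for the wedge\<close>

lemma finite_OC: "finite OC"
  by (rule finite_subset[of _ "Pow (Pow S)"])
    (use fin_S P_sub in \<open>auto simp: order_complex_def P_proper_eq\<close>)

lemma shelling_OC:
  obtains fs where "distinct fs" "set fs = facets OC"
    "\<forall>j. 0 < j \<and> j < length fs \<longrightarrow> pure_card {G. G \<subseteq> fs ! j \<and> (\<exists>i<j. G \<subseteq> fs ! i)} (k - 1 - 1)"
proof -
  \<comment> \<open>A facet determines its flag only up to rank \<open>k\<close>;
    \<open>keys\<close> reads no values beyond that, so the choice does not affect the
    order.\<close>
  define fl where "fl F = (SOME c. flag c \<and> F = c ` {1..<k})" for F
  have fl: "flag (fl F)" "F = fl F ` {1..<k}" if "F \<in> facets OC" for F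
  proof -
    have "\<exists>c. flag c \<and> F = c ` {1..<k}" using facet_flag[OF that] by blast
    then have "flag (fl F) \<and> F = fl F ` {1..<k}" unfolding fl_def by (rule someI_ex)
    then show "flag (fl F)" "F = fl F ` {1..<k}" by auto
  qed
  have "finite (facets OC)" using finite_OC by (auto simp: facets_def)
  then obtain xs where xs: "distinct xs" "set xs = facets OC" using finite_distinct_list by metis
  define fs where "fs = sort_key (\<lambda>F. keys (fl F)) xs"
  have fs: "distinct fs" "set fs = facets OC" using xs by (auto simp: fs_def)
  have sorted: "keys (fl (fs ! i)) \<le> keys (fl (fs ! j))" if "i \<le> j" "j < length fs" for i j
    using sorted_nth_mono[OF sorted_sort_key[of "\<lambda>F. keys (fl F)" xs, folded fs_def]] that by simp
  have "pure_card {G. G \<subseteq> fs ! j \<and> (\<exists>i<j. G \<subseteq> fs ! i)} (k - 1 - 1)" if j: "0 < j" "j < length fs" for j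
  proof (rule shelling_criterion[OF _ fs(1) j])
    show "finite F \<and> card F = k - 1" if "F \<in> set fs" for F
    proof -
      have F: "F \<in> facets OC" using that fs(2) by simp
      then have "card F = k - 1" using flag_image(2)[OF fl(1)[OF F]] fl(2)[OF F] by simp
      moreover have "finite F" using F by (auto simp: facets_def order_complex_def)
      ultimately show ?thesis by simp
    qed
    fix i assume i: "i < j"
    have Fj: "fs ! j \<in> facets OC" and Fi: "fs ! i \<in> facets OC" using i j nth_mem fs(2) by (auto simp flip: fs(2))
    define c where "c = fl (fs ! j)"
    define c' where "c' = fl (fs ! i)"
    have c: "flag c" "fs ! j = c ` {1..<k}" and c': "flag c'" "fs ! i = c' ` {1..<k}"
      using fl Fi Fj by (auto simp: c_def c'_def)
    have "keys c' \<noteq> keys c"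
    proof
      assume "keys c' = keys c"
      then have "c' m = c m" if "m \<le> k" for m using keys_inj[OF c'(1) c(1)] that by simp
      then have "fs ! i = fs ! j" unfolding c(2) c'(2) by (intro image_cong) auto
      then show False using fs(1) i j(2) by (simp add: nth_eq_iff_index_eq)
    qed
    then have "keys c' < keys c" using sorted[of i j] i j(2) by (simp add: c_def c'_def)
    then obtain l c'' where l: "0 < l" "l < k" and c'': "flag c''" "keys c'' < keys c"
      "\<forall>i. i \<noteq> l \<longrightarrow> c'' i = c i" "c l \<notin> c' ` {1..<k}"
      by (rule flag_exchange[OF c(1) c'(1)])
    have F'': "c'' ` {1..<k} \<in> facets OC" using flag_image(1)[OF c''(1)] .
    then obtain l' where l': "l' < length fs" "c'' ` {1..<k} = fs ! l'"
      unfolding fs(2)[symmetric] in_set_conv_nth by metis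
    have "fl (fs ! l') m = c'' m" if "m \<le> k" for m
      using flag_eq[OF fl(1)[OF F''] c''(1) fl(2)[OF F'', symmetric] that] l'(2) by simp
    then have "keys (fl (fs ! l')) = keys c''" unfolding keys_def by simp
    then have "l' < j" using sorted[of j l'] c''(2) l'(1) unfolding c_def[symmetric]
      by (metis leD not_le_imp_less)
    moreover have "c l \<in> fs ! j" unfolding c(2) using l by auto
    moreover have "fs ! i \<inter> fs ! j \<subseteq> fs ! j - {c l}" using c''(4) c'(2) by blast
    moreover have "fs ! j - {c l} \<subseteq> fs ! l'"
    proof
      fix y assume y: "y \<in> fs ! j - {c l}"
      then obtain m where m: "m \<in> {1..<k}" "y = c m" unfolding c(2) by blast
      then have "m \<noteq> l" using y by blast
      then have "y = c'' m" using c''(3) m(2) by simp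
      then show "y \<in> fs ! l'" unfolding l'(2)[symmetric] using m(1) by simp
    qed
    ultimately show "\<exists>l<j. \<exists>v\<in>fs ! j. fs ! i \<inter> fs ! j \<subseteq> fs ! j - {v} \<and> fs ! j - {v} \<subseteq> fs ! l" by blast
  qed
  then show ?thesis using that[OF fs] by blast
qed

lemma shellable_OC: "shellable OC"
proof -
  obtain fs where "distinct fs" "set fs = facets OC"
    "\<forall>j. 0 < j \<and> j < length fs \<longrightarrow> pure_card {G. G \<subseteq> fs ! j \<and> (\<exists>i<j. G \<subseteq> fs ! i)} (k - 1 - 1)"
    by (rule shelling_OC)
  then show ?thesis
    unfolding shellable_def using pure_OC k by (intro exI[of _ "k - 1"] exI[of _ fs] conjI) auto
qed

lemma OC_down:
  assumes "G \<in> OC" "G' \<subseteq> G" "G' \<noteq> {}"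
  shows "G' \<in> OC"
proof -
  have G: "finite G" "G \<subseteq> P_proper S B" "\<forall>x\<in>G. \<forall>y\<in>G. x \<subseteq> y \<or> y \<subseteq> x"
    using assms(1) by (simp_all add: order_complex_def)
  have "finite G'" "G' \<subseteq> P_proper S B" using finite_subset assms(2) G by auto
  moreover have "\<forall>x\<in>G'. \<forall>y\<in>G'. x \<subseteq> y \<or> y \<subseteq> x" using assms(2) G(3) by (meson subsetD)
  ultimately show ?thesis using assms(3) by (simp add: order_complex_def)
qed

text \<open>A lower neighbour of \<open>S\<close> has \<open>2 * k - 2\<close> elements, a positive
  number because \<open>k\<close> is at least 2.\<close>

lemma OC_nonempty: "OC \<noteq> {}"
proof -
  have "S \<noteq> {}" using card_S k by auto
  then obtain z where "first z {} S" using first_exists[OF empty_P S_P] by blast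
  then have z: "z \<in> P" "z \<subseteq> S" "card (S - z) = 2" by (auto simp: first_def Q_def)
  have "card (S - z) = card S - card z" using z P_fin by (intro card_Diff_subset) auto
  then have "z \<noteq> {}" "z \<noteq> S" using z(3) card_S k by auto
  then have "{z} \<in> OC" using z(1) by (auto simp: order_complex_def P_proper_eq)
  then show ?thesis by blast
qed

end

theorem theorem3p4:
  fixes S :: "nat set" and B :: "nat set set" and k :: nat
  assumes "finite S"
      and "building_set S B"
      and "chordal B"
      and "card S = 2 * k"
      and "k \<ge> 2"
      and "\<forall>C\<in>bs_components B. even (card C)"
  shows "shellable (order_complex (P_proper S B)) \<and>
         (\<exists>N. top_of_set (geom_realization (order_complex (P_proper S B)))
                 homotopy_equivalent_space
               top_of_set (wedge_of_spheres N (k - 2)))"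
proof -
  interpret chordal_building_set S B
    using assms(2,3) by unfold_locales
  have "bs_restrict B S = B"
    using B_sub by (auto simp: bs_restrict_def)
  then have "S \<in> P"
    using assms(6) by (simp add: P_iff comps_def)
  then interpret even_chordal_building_set S B k
    using assms(4,5) by unfold_locales
  obtain fs where fs: "distinct fs" "set fs = facets OC"
    "\<forall>j. 0 < j \<and> j < length fs \<longrightarrow> pure_card {G. G \<subseteq> fs ! j \<and> (\<exists>i<j. G \<subseteq> fs ! i)} (k - 1 - 1)"
    by (rule shelling_OC)
  \<comment> \<open>A facet has \<open>k - 1\<close> members and thus dimension
    \<open>k - 2\<close>, the dimension of the spheres.\<close>
  have "\<exists>N. top_of_set (geom_realization OC) homotopy_equivalent_space top_of_set (wedge_of_spheres N (k - 1 - 1))"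
  proof (rule shelling_homotopy_equivalent_wedge[OF finite_OC _ OC_nonempty _ pure_OC fs(1,2)])
    show "finite G \<and> G \<noteq> {}" if "G \<in> OC" for G
      using that by (simp add: order_complex_def)
    show "G' \<in> OC" if "G \<in> OC" "G' \<subseteq> G" "G' \<noteq> {}" for G G'
      using that by (rule OC_down)
  qed (use fs(3) in blast)
  then show ?thesis
    using shellable_OC by (simp add: numeral_2_eq_2)
qed

end
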